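(* Let $k$ be a field, let $\Gamma$ be an abelian group, and let $S=\bigoplus_{\alpha\in\Gamma}S_\alpha$ be a $\Gamma$-graded $k$-algebra such that $S_0=k$. Suppose the only homogeneous units in $S$ are the elements of $k-\{0\}$. Then: (1) $\mathfrak{m}:=\sum_{\alpha\ne0}S_\alpha$ is the unique maximal graded ideal of $S$; (2) if $M$ is a finitely generated graded $S$-module such that $\mathfrak{m}M=M$, then $M=0$; (3) if $P$ is a finitely generated projective graded $S$-module, then $P$ is isomorphic to a direct sum of graded free modules $S(\alpha)$ for various $\alpha$'s in $\Gamma$; (4) two graded free modules $P:=S(\alpha_1)\oplus\dots\oplus S(\alpha_m)$ and $Q:=S(\beta_1)\oplus\dots\oplus S(\beta_n)$ are isomorphic if and only if there is an equality of multi-sets $\{\{\alpha_1,\dots,\alpha_m\}\}=\{\{\beta_1,\dots,\beta_n\}\}$.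
   Context: $S$ is not assumed to be commutative, and $\Gamma$ may have torsion. Graded modules are $\Gamma$-graded left modules; morphisms and isomorphisms are degree-preserving. The twist $M(\alpha)$ of a graded module $M$ is $M$ with the grading $M(\alpha)_\beta=M_{\alpha+\beta}$. *)

theory Defs
  imports "HOL-Algebra.Algebra" "HOL-Library.Multiset"
begin

section \<open>Graded objects\<close>

text \<open>
  One record type serves graded algebras and graded modules: a graded \<open>k\<close>-algebra \<open>S\<close> uses
  \<open>smult\<close> for the action of \<open>k\<close> and the inherited \<open>mult\<close> and \<open>one\<close> for its ring structure, whereas
  for a graded \<open>S\<close>-module \<open>smult\<close> is the action of \<open>S\<close> and \<open>mult\<close>, \<open>one\<close> are ignored (as they
  are for the type \<^type>\<open>module\<close> of the library).
\<close>

record ('g, 'a, 'b) gmodule = "('a, 'b) module" +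
  grade :: "'g \<Rightarrow> 'b set"

definition is_grading :: "('g, 'a, 'b) gmodule \<Rightarrow> bool" where
  "is_grading M \<longleftrightarrow>
     (\<forall>\<alpha>. additive_subgroup (grade M \<alpha>) M) \<and>
     (\<forall>x\<in>carrier M. \<exists>!f. (\<forall>\<alpha>. f \<alpha> \<in> grade M \<alpha>) \<and> finite {\<alpha>. f \<alpha> \<noteq> \<zero>\<^bsub>M\<^esub>} \<and>
        x = finsum M f {\<alpha>. f \<alpha> \<noteq> \<zero>\<^bsub>M\<^esub>})"

text \<open>The library locale \<^locale>\<open>algebra\<close> is restricted to commutative algebras.\<close>

locale graded_algebra = ring S + K: field K + KS: module K S
  for K :: "'k ring" and S :: "('g::ab_group_add, 'k, 's) gmodule" (structure) +
  assumes smult_mult_left: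
      "\<lbrakk>a \<in> carrier K; x \<in> carrier S; y \<in> carrier S\<rbrakk> \<Longrightarrow> (a \<odot> x) \<otimes> y = a \<odot> (x \<otimes> y)"
    and smult_mult_right:
      "\<lbrakk>a \<in> carrier K; x \<in> carrier S; y \<in> carrier S\<rbrakk> \<Longrightarrow> x \<otimes> (a \<odot> y) = a \<odot> (x \<otimes> y)"
    and grading: "is_grading S"
    and grade_smult: "\<lbrakk>a \<in> carrier K; x \<in> grade S \<alpha>\<rbrakk> \<Longrightarrow> a \<odot> x \<in> grade S \<alpha>"
    and grade_mult: "\<lbrakk>x \<in> grade S \<alpha>; y \<in> grade S \<beta>\<rbrakk> \<Longrightarrow> x \<otimes> y \<in> grade S (\<alpha> + \<beta>)"
    and grade_one: "\<one> \<in> grade S 0"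

text \<open>Likewise, the library locale \<^locale>\<open>module\<close> requires a commutative base ring.\<close>

locale graded_module = R: ring S + M: abelian_group M
  for S :: "('g::ab_group_add, 'k, 's) gmodule" and M :: "('g, 's, 'm) gmodule" +
  assumes smult_closed: "\<lbrakk>a \<in> carrier S; x \<in> carrier M\<rbrakk> \<Longrightarrow> a \<odot>\<^bsub>M\<^esub> x \<in> carrier M"
    and smult_l_distr: "\<lbrakk>a \<in> carrier S; b \<in> carrier S; x \<in> carrier M\<rbrakk> \<Longrightarrow>
      (a \<oplus>\<^bsub>S\<^esub> b) \<odot>\<^bsub>M\<^esub> x = a \<odot>\<^bsub>M\<^esub> x \<oplus>\<^bsub>M\<^esub> b \<odot>\<^bsub>M\<^esub> x"
    and smult_r_distr: "\<lbrakk>a \<in> carrier S; x \<in> carrier M; y \<in> carrier M\<rbrakk> \<Longrightarrow>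
      a \<odot>\<^bsub>M\<^esub> (x \<oplus>\<^bsub>M\<^esub> y) = a \<odot>\<^bsub>M\<^esub> x \<oplus>\<^bsub>M\<^esub> a \<odot>\<^bsub>M\<^esub> y"
    and smult_assoc: "\<lbrakk>a \<in> carrier S; b \<in> carrier S; x \<in> carrier M\<rbrakk> \<Longrightarrow>
      (a \<otimes>\<^bsub>S\<^esub> b) \<odot>\<^bsub>M\<^esub> x = a \<odot>\<^bsub>M\<^esub> (b \<odot>\<^bsub>M\<^esub> x)"
    and smult_one: "x \<in> carrier M \<Longrightarrow> \<one>\<^bsub>S\<^esub> \<odot>\<^bsub>M\<^esub> x = x"
    and grading: "is_grading M"
    and grade_smult: "\<lbrakk>a \<in> grade S \<alpha>; x \<in> grade M \<beta>\<rbrakk> \<Longrightarrow> a \<odot>\<^bsub>M\<^esub> x \<in> grade M (\<alpha> + \<beta>)"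

definition gr_hom :: "('g, 'k, 's) gmodule \<Rightarrow> ('g, 's, 'm) gmodule \<Rightarrow> ('g, 's, 'n) gmodule \<Rightarrow>
    ('m \<Rightarrow> 'n) set" where
  "gr_hom S M N = {f \<in> hom (add_monoid M) (add_monoid N).
     (\<forall>a\<in>carrier S. \<forall>x\<in>carrier M. f (a \<odot>\<^bsub>M\<^esub> x) = a \<odot>\<^bsub>N\<^esub> f x) \<and>
     (\<forall>\<alpha>. \<forall>x\<in>grade M \<alpha>. f x \<in> grade N \<alpha>)}"

definition gr_isomorphic :: "('g, 'k, 's) gmodule \<Rightarrow> ('g, 's, 'm) gmodule \<Rightarrow> ('g, 's, 'n) gmodule \<Rightarrow>
    bool" where
  "gr_isomorphic S M N \<longleftrightarrow> (\<exists>f\<in>gr_hom S M N. \<exists>g\<in>gr_hom S N M.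
     (\<forall>x\<in>carrier M. g (f x) = x) \<and> (\<forall>y\<in>carrier N. f (g y) = y))"

section \<open>Twists, direct sums, graded free modules\<close>

definition regular :: "('g, 'k, 's) gmodule \<Rightarrow> ('g, 's, 's) gmodule" where
  "regular S = \<lparr>carrier = carrier S, monoid.mult = monoid.mult S, one = one S, ring.zero = ring.zero S, ring.add = ring.add S,
     smult = monoid.mult S, grade = grade S\<rparr>"

definition twist :: "('g::ab_group_add, 'a, 'b) gmodule \<Rightarrow> 'g \<Rightarrow> ('g, 'a, 'b) gmodule" where
  "twist M \<alpha> = M\<lparr>grade := \<lambda>\<beta>. grade M (\<alpha> + \<beta>)\<rparr>"

definition gr_direct_sum :: "'i set \<Rightarrow> ('i \<Rightarrow> ('g, 'a, 'b) gmodule) \<Rightarrow> ('g, 'a, 'i \<Rightarrow> 'b) gmodule" where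
  "gr_direct_sum I M =
     \<lparr>carrier = {x \<in> \<Pi>\<^sub>E i\<in>I. carrier (M i). finite {i\<in>I. x i \<noteq> \<zero>\<^bsub>M i\<^esub>}},
      monoid.mult = undefined, one = undefined,
      ring.zero = (\<lambda>i\<in>I. \<zero>\<^bsub>M i\<^esub>),
      ring.add = (\<lambda>x y. \<lambda>i\<in>I. x i \<oplus>\<^bsub>M i\<^esub> y i),
      smult = (\<lambda>a x. \<lambda>i\<in>I. a \<odot>\<^bsub>M i\<^esub> x i),
      grade = (\<lambda>\<alpha>. {x \<in> \<Pi>\<^sub>E i\<in>I. grade (M i) \<alpha>. finite {i\<in>I. x i \<noteq> \<zero>\<^bsub>M i\<^esub>}})\<rparr>"

definition gr_free :: "('g::ab_group_add, 'k, 's) gmodule \<Rightarrow> 'g list \<Rightarrow> ('g, 's, nat \<Rightarrow> 's) gmodule" where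
  "gr_free S \<alpha>s = gr_direct_sum {..<length \<alpha>s} (\<lambda>i. twist (regular S) (\<alpha>s ! i))"

section \<open>Graded ideals\<close>

text \<open>\<open>S\<close> is noncommutative; ideals are two-sided, and maximality is among proper graded ideals.\<close>

definition graded_ideal :: "('g, 'k, 's) gmodule \<Rightarrow> 's set \<Rightarrow> bool" where
  "graded_ideal S I \<longleftrightarrow> ideal I S \<and> I = generate (add_monoid S) (\<Union>\<alpha>. I \<inter> grade S \<alpha>)"

definition maximal_graded_ideal :: "('g, 'k, 's) gmodule \<Rightarrow> 's set \<Rightarrow> bool" where
  "maximal_graded_ideal S I \<longleftrightarrow> graded_ideal S I \<and> I \<noteq> carrier S \<and>
     (\<forall>J. graded_ideal S J \<and> I \<subseteq> J \<longrightarrow> J = I \<or> J = carrier S)"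

definition nonzero_degree_part :: "('g::zero, 'k, 's) gmodule \<Rightarrow> 's set" where
  "nonzero_degree_part S = generate (add_monoid S) (\<Union>\<alpha>\<in>- {0}. grade S \<alpha>)"

definition ideal_smult :: "'s set \<Rightarrow> ('g, 's, 'm) gmodule \<Rightarrow> 'm set" where
  "ideal_smult I M = generate (add_monoid M) {a \<odot>\<^bsub>M\<^esub> x | a x. a \<in> I \<and> x \<in> carrier M}"

section \<open>Finitely generated and projective graded modules\<close>

definition fin_gen :: "('g, 'k, 's) gmodule \<Rightarrow> ('g, 's, 'm) gmodule \<Rightarrow> bool" where
  "fin_gen S M \<longleftrightarrow> (\<exists>A. finite A \<and> A \<subseteq> carrier M \<and>
     (\<forall>x\<in>carrier M. \<exists>c \<in> A \<rightarrow> carrier S. x = (\<Oplus>\<^bsub>M\<^esub>a\<in>A. c a \<odot>\<^bsub>M\<^esub> a)))"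

text \<open>
  Projectivity is the lifting property against surjections of graded modules. A definition cannot
  quantify over types, so the carrier types of the test modules are fixed; the theorem
  \<open>gr_projective_lift\<close> below shows that the lifting property for test modules over arbitrary
  types follows.
\<close>

definition gr_projective :: "('g::ab_group_add, 'k, 's) gmodule \<Rightarrow> ('g, 's, 'p) gmodule \<Rightarrow> bool" where
  "gr_projective S P \<longleftrightarrow> graded_module S P \<and>
     (\<forall>(M :: ('g, 's, 'p \<Rightarrow> 's) gmodule) (N :: ('g, 's, 'p) gmodule). \<forall>g\<in>gr_hom S M N. \<forall>f\<in>gr_hom S P N.
        graded_module S M \<and> graded_module S N \<and> g ` carrier M = carrier N \<longrightarrow>
        (\<exists>h\<in>gr_hom S P M. \<forall>x\<in>carrier P. g (h x) = f x))"

section \<open>The choice of carrier types in the definition of projectivity is immaterial\<close>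

lemma gr_direct_sum_simps:
  "carrier (gr_direct_sum I M) = {x \<in> \<Pi>\<^sub>E i\<in>I. carrier (M i). finite {i\<in>I. x i \<noteq> \<zero>\<^bsub>M i\<^esub>}}"
  "\<zero>\<^bsub>gr_direct_sum I M\<^esub> = (\<lambda>i\<in>I. \<zero>\<^bsub>M i\<^esub>)"
  "x \<oplus>\<^bsub>gr_direct_sum I M\<^esub> y = (\<lambda>i\<in>I. x i \<oplus>\<^bsub>M i\<^esub> y i)"
  "a \<odot>\<^bsub>gr_direct_sum I M\<^esub> x = (\<lambda>i\<in>I. a \<odot>\<^bsub>M i\<^esub> x i)"
  "grade (gr_direct_sum I M) \<alpha> = {x \<in> \<Pi>\<^sub>E i\<in>I. grade (M i) \<alpha>. finite {i\<in>I. x i \<noteq> \<zero>\<^bsub>M i\<^esub>}}"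
  by (simp_all add: gr_direct_sum_def)

lemma regular_simps [simp]:
  "carrier (regular S) = carrier S" "\<zero>\<^bsub>regular S\<^esub> = \<zero>\<^bsub>S\<^esub>"
  "x \<oplus>\<^bsub>regular S\<^esub> y = x \<oplus>\<^bsub>S\<^esub> y" "x \<odot>\<^bsub>regular S\<^esub> y = x \<otimes>\<^bsub>S\<^esub> y" "grade (regular S) = grade S"
  by (simp_all add: regular_def)

lemma twist_simps [simp]:
  "carrier (twist M \<alpha>) = carrier M" "\<zero>\<^bsub>twist M \<alpha>\<^esub> = \<zero>\<^bsub>M\<^esub>"
  "x \<oplus>\<^bsub>twist M \<alpha>\<^esub> y = x \<oplus>\<^bsub>M\<^esub> y" "a \<odot>\<^bsub>twist M \<alpha>\<^esub> y = a \<odot>\<^bsub>M\<^esub> y"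
  "grade (twist M \<alpha>) \<beta> = grade M (\<alpha> + \<beta>)"
  by (simp_all add: twist_def)

lemma finsum_same_add:
  assumes "carrier M = carrier N" "\<zero>\<^bsub>M\<^esub> = \<zero>\<^bsub>N\<^esub>" "\<And>x y. x \<oplus>\<^bsub>M\<^esub> y = x \<oplus>\<^bsub>N\<^esub> y"
  shows "finsum M = finsum N"
proof -
  have "ring.add M = ring.add N" using assms(3) by (intro ext) simp
  then show ?thesis
    using assms(1,2) by (intro ext) (simp add: finsum_def finprod_def)
qed

lemma additive_subgroup_iff:
  assumes "abelian_group M"
  shows "additive_subgroup H M \<longleftrightarrow>
    H \<subseteq> carrier M \<and> \<zero>\<^bsub>M\<^esub> \<in> H \<and> (\<forall>x\<in>H. \<forall>y\<in>H. x \<oplus>\<^bsub>M\<^esub> y \<in> H) \<and> (\<forall>x\<in>H. \<ominus>\<^bsub>M\<^esub> x \<in> H)"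
  using assms by (auto simp: additive_subgroup_def subgroup_def a_inv_def)

lemma abelian_group_same_add:
  assumes "abelian_group N"
    "carrier M = carrier N" "\<zero>\<^bsub>M\<^esub> = \<zero>\<^bsub>N\<^esub>" "\<And>x y. x \<oplus>\<^bsub>M\<^esub> y = x \<oplus>\<^bsub>N\<^esub> y"
  shows "abelian_group M"
proof -
  interpret N: abelian_group N by fact
  show ?thesis
  proof (rule abelian_groupI, unfold assms(2-4))
    fix x assume "x \<in> carrier N"
    then show "\<exists>y\<in>carrier N. y \<oplus>\<^bsub>N\<^esub> x = \<zero>\<^bsub>N\<^esub>"
      by (intro bexI[of _ "\<ominus>\<^bsub>N\<^esub> x"]) (auto simp: N.l_neg)
  qed (auto simp: N.a_assoc intro: N.a_comm)
qed

context graded_module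
begin

lemma grade_subset: "grade M \<alpha> \<subseteq> carrier M"
  using grading M.abelian_group_axioms by (auto simp: is_grading_def additive_subgroup_iff)

lemma grade_closed: "x \<in> grade M \<alpha> \<Longrightarrow> x \<in> carrier M"
  using grade_subset by blast

lemma zero_grade: "\<zero>\<^bsub>M\<^esub> \<in> grade M \<alpha>"
  and add_grade: "x \<in> grade M \<alpha> \<Longrightarrow> y \<in> grade M \<alpha> \<Longrightarrow> x \<oplus>\<^bsub>M\<^esub> y \<in> grade M \<alpha>"
  and minus_grade: "x \<in> grade M \<alpha> \<Longrightarrow> \<ominus>\<^bsub>M\<^esub> x \<in> grade M \<alpha>"
  using grading M.abelian_group_axioms by (auto simp: is_grading_def additive_subgroup_iff)

lemma finsum_grade: "(\<And>i. i \<in> A \<Longrightarrow> f i \<in> grade M \<alpha>) \<Longrightarrow> finsum M f A \<in> grade M \<alpha>"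
proof (induct A rule: infinite_finite_induct)
  case (insert a A)
  then have "finsum M f (insert a A) = f a \<oplus>\<^bsub>M\<^esub> finsum M f A"
    by (intro M.finsum_insert) (auto intro: grade_closed)
  then show ?case using insert by (auto intro: add_grade)
qed (auto simp: zero_grade)

lemma smult_zero: "a \<in> carrier S \<Longrightarrow> a \<odot>\<^bsub>M\<^esub> \<zero>\<^bsub>M\<^esub> = \<zero>\<^bsub>M\<^esub>"
  using smult_r_distr[of a "\<zero>\<^bsub>M\<^esub>" "\<zero>\<^bsub>M\<^esub>"] smult_closed[of a "\<zero>\<^bsub>M\<^esub>"]
  by (metis M.zero_closed M.l_zero M.add.l_cancel_one)

lemma zero_smult: "x \<in> carrier M \<Longrightarrow> \<zero>\<^bsub>S\<^esub> \<odot>\<^bsub>M\<^esub> x = \<zero>\<^bsub>M\<^esub>"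
  using smult_l_distr[of "\<zero>\<^bsub>S\<^esub>" "\<zero>\<^bsub>S\<^esub>" x] smult_closed[of "\<zero>\<^bsub>S\<^esub>" x]
  by (metis R.zero_closed R.l_zero M.add.l_cancel_one)

lemma smult_finsum:
  assumes "a \<in> carrier S" "f \<in> A \<rightarrow> carrier M"
  shows "a \<odot>\<^bsub>M\<^esub> finsum M f A = (\<Oplus>\<^bsub>M\<^esub>i\<in>A. a \<odot>\<^bsub>M\<^esub> f i)"
  using assms(2)
proof (induct A rule: infinite_finite_induct)
  case (insert x A)
  then show ?case
    using assms(1) by (subst (1 2) M.finsum_insert) (auto simp: smult_r_distr smult_closed Pi_iff)
qed (auto simp: smult_zero assms)

definition is_decomp :: "'m \<Rightarrow> ('g \<Rightarrow> 'm) \<Rightarrow> bool" where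
  "is_decomp x f \<longleftrightarrow> (\<forall>\<alpha>. f \<alpha> \<in> grade M \<alpha>) \<and> finite {\<alpha>. f \<alpha> \<noteq> \<zero>\<^bsub>M\<^esub>} \<and>
     x = finsum M f {\<alpha>. f \<alpha> \<noteq> \<zero>\<^bsub>M\<^esub>}"

lemma decomp_ex1: "x \<in> carrier M \<Longrightarrow> \<exists>!f. is_decomp x f"
  using grading unfolding is_grading_def is_decomp_def by blast

definition component :: "'m \<Rightarrow> 'g \<Rightarrow> 'm" where
  "component x = (THE f. is_decomp x f)"

lemma comp_decomp: "x \<in> carrier M \<Longrightarrow> is_decomp x (component x)"
  unfolding component_def using theI'[OF decomp_ex1] .

lemma comp_grade: "x \<in> carrier M \<Longrightarrow> component x \<alpha> \<in> grade M \<alpha>"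
  using comp_decomp by (auto simp: is_decomp_def)

lemma comp_finite: "x \<in> carrier M \<Longrightarrow> finite {\<alpha>. component x \<alpha> \<noteq> \<zero>\<^bsub>M\<^esub>}"
  using comp_decomp by (auto simp: is_decomp_def)

lemma finsum_extend:
  assumes "finite B" "A \<subseteq> B" "\<And>i. i \<in> B - A \<Longrightarrow> f i = \<zero>\<^bsub>M\<^esub>" "\<And>i. i \<in> B \<Longrightarrow> f i \<in> carrier M"
  shows "finsum M f A = finsum M f B"
  using assms by (intro M.add.finprod_mono_neutral_cong_left[simplified]) auto

lemma decompI:
  assumes "\<And>\<alpha>. f \<alpha> \<in> grade M \<alpha>" "finite B" "\<And>\<alpha>. \<alpha> \<notin> B \<Longrightarrow> f \<alpha> = \<zero>\<^bsub>M\<^esub>" "x = finsum M f B"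
  shows "is_decomp x f"
proof -
  have sub: "{\<alpha>. f \<alpha> \<noteq> \<zero>\<^bsub>M\<^esub>} \<subseteq> B" using assms(3) by auto
  show ?thesis unfolding is_decomp_def
    using assms(1) finite_subset[OF sub assms(2)] assms(4)
      finsum_extend[OF assms(2) sub, of f] assms(3) grade_closed[OF assms(1)] by simp
qed

lemma comp_eqI:
  assumes "\<And>\<alpha>. f \<alpha> \<in> grade M \<alpha>" "finite B" "\<And>\<alpha>. \<alpha> \<notin> B \<Longrightarrow> f \<alpha> = \<zero>\<^bsub>M\<^esub>" "x = finsum M f B"
  shows "component x = f"
proof -
  have "x \<in> carrier M" unfolding assms(4)
    using assms(1) by (intro M.finsum_closed) (auto intro: grade_closed)
  then show ?thesis using decomp_ex1 comp_decomp decompI[OF assms] by blast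
qed

lemma finsum_comp:
  assumes "x \<in> carrier M" "finite B" "\<And>\<alpha>. \<alpha> \<notin> B \<Longrightarrow> component x \<alpha> = \<zero>\<^bsub>M\<^esub>"
  shows "finsum M (component x) B = x"
proof -
  have "{\<alpha>. component x \<alpha> \<noteq> \<zero>\<^bsub>M\<^esub>} \<subseteq> B" using assms(3) by auto
  then have "finsum M (component x) {\<alpha>. component x \<alpha> \<noteq> \<zero>\<^bsub>M\<^esub>} = finsum M (component x) B"
    using assms by (intro finsum_extend) (auto intro: grade_closed comp_grade)
  then show ?thesis using comp_decomp[OF assms(1)] by (simp add: is_decomp_def)
qed

lemma comp_homogeneous:
  assumes "x \<in> grade M \<alpha>"
  shows "component x = (\<lambda>\<beta>. if \<beta> = \<alpha> then x else \<zero>\<^bsub>M\<^esub>)"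
proof (rule comp_eqI[of _ "{\<alpha>}"])
  show "x = finsum M (\<lambda>\<beta>. if \<beta> = \<alpha> then x else \<zero>\<^bsub>M\<^esub>) {\<alpha>}"
    using grade_closed[OF assms] by (subst M.finsum_insert) auto
qed (use assms zero_grade in auto)

lemma graded_module_twist: "graded_module S (twist M \<delta>)"
proof -
  interpret T: abelian_group "twist M \<delta>"
    by (rule abelian_group_same_add[OF M.abelian_group_axioms]) auto
  have fs: "finsum (twist M \<delta>) = finsum M" by (rule finsum_same_add) auto
  have minus: "\<ominus>\<^bsub>twist M \<delta>\<^esub> x = \<ominus>\<^bsub>M\<^esub> x" if "x \<in> carrier M" for x
  proof (rule T.minus_equality)
    show "\<ominus>\<^bsub>M\<^esub> x \<oplus>\<^bsub>twist M \<delta>\<^esub> x = \<zero>\<^bsub>twist M \<delta>\<^esub>" using that by (simp add: M.l_neg)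
  qed (use that in auto)
  have "\<exists>!f. (\<forall>\<alpha>. f \<alpha> \<in> grade (twist M \<delta>) \<alpha>) \<and> finite {\<alpha>. f \<alpha> \<noteq> \<zero>\<^bsub>twist M \<delta>\<^esub>} \<and>
        x = finsum (twist M \<delta>) f {\<alpha>. f \<alpha> \<noteq> \<zero>\<^bsub>twist M \<delta>\<^esub>}" (is "\<exists>!f. ?P f")
    if x: "x \<in> carrier M" for x
  proof
    let ?f = "\<lambda>\<alpha>. component x (\<delta> + \<alpha>)"
    have im: "(+) \<delta> ` {\<alpha>. ?f \<alpha> \<noteq> \<zero>\<^bsub>M\<^esub>} = {\<alpha>. component x \<alpha> \<noteq> \<zero>\<^bsub>M\<^esub>}"
      by (auto simp: image_iff) (metis add.commute diff_add_cancel)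
    have fin: "finite {\<alpha>. ?f \<alpha> \<noteq> \<zero>\<^bsub>M\<^esub>}"
      using comp_finite[OF x] im by (metis (no_types, lifting) finite_imageD inj_on_add)
    have "x = finsum M (component x) ((+) \<delta> ` {\<alpha>. ?f \<alpha> \<noteq> \<zero>\<^bsub>M\<^esub>})"
      unfolding im using comp_decomp[OF x] by (simp add: is_decomp_def)
    also have "\<dots> = finsum M ?f {\<alpha>. ?f \<alpha> \<noteq> \<zero>\<^bsub>M\<^esub>}"
      using x by (intro M.finsum_reindex) (auto intro: grade_closed comp_grade)
    finally show "?P ?f" using fin x by (simp add: fs comp_grade)
  next
    fix f assume f: "?P f"
    have im: "(+) \<delta> ` {\<alpha>. f \<alpha> \<noteq> \<zero>\<^bsub>M\<^esub>} = {\<alpha>. f (\<alpha> - \<delta>) \<noteq> \<zero>\<^bsub>M\<^esub>}"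
      by (auto simp: image_iff) (metis add.commute diff_add_cancel)
    have fin: "finite {\<alpha>. f (\<alpha> - \<delta>) \<noteq> \<zero>\<^bsub>M\<^esub>}"
      unfolding im[symmetric] using f by simp
    have g: "f (\<alpha> - \<delta>) \<in> grade M \<alpha>" for \<alpha>
      using f by (auto dest!: spec[of _ "\<alpha> - \<delta>"])
    have "component x = (\<lambda>\<alpha>. f (\<alpha> - \<delta>))"
    proof (rule comp_eqI[of _ "(+) \<delta> ` {\<alpha>. f \<alpha> \<noteq> \<zero>\<^bsub>M\<^esub>}"])
      have "finsum M (\<lambda>\<alpha>. f (\<alpha> - \<delta>)) ((+) \<delta> ` {\<alpha>. f \<alpha> \<noteq> \<zero>\<^bsub>M\<^esub>}) = finsum M f {\<alpha>. f \<alpha> \<noteq> \<zero>\<^bsub>M\<^esub>}"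
        using g by (subst M.finsum_reindex) (auto intro: grade_closed)
      then show "x = finsum M (\<lambda>\<alpha>. f (\<alpha> - \<delta>)) ((+) \<delta> ` {\<alpha>. f \<alpha> \<noteq> \<zero>\<^bsub>M\<^esub>})"
        using f by (simp add: fs)
    qed (use fin g im in auto)
    then show "f = (\<lambda>\<alpha>. component x (\<delta> + \<alpha>))" by simp
  qed
  then have "is_grading (twist M \<delta>)"
    unfolding is_grading_def additive_subgroup_iff[OF T.abelian_group_axioms]
    using grade_subset add_grade zero_grade minus minus_grade
    by (auto simp: subset_iff)
  then show ?thesis
    by unfold_locales
      (auto simp: smult_closed smult_l_distr smult_r_distr smult_assoc smult_one add.left_commute
        dest: grade_smult)
qed

end

context graded_algebra
begin

lemma graded_module_regular: "graded_module S (regular S)"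
proof -
  interpret T: abelian_group "regular S"
    by (rule abelian_group_same_add[OF is_abelian_group]) auto
  have fs: "finsum (regular S) = finsum S" by (rule finsum_same_add) auto
  have minus: "\<ominus>\<^bsub>regular S\<^esub> x = \<ominus> x" if "x \<in> carrier S" for x
  proof (rule T.minus_equality)
    show "\<ominus> x \<oplus>\<^bsub>regular S\<^esub> x = \<zero>\<^bsub>regular S\<^esub>" using that by (simp add: l_neg)
  qed (use that in auto)
  have "is_grading (regular S)"
    using grading minus
    unfolding is_grading_def additive_subgroup_iff[OF T.abelian_group_axioms]
      additive_subgroup_iff[OF is_abelian_group]
    by (simp add: fs subset_iff)
  then show ?thesis
    by unfold_locales (auto simp: l_distr r_distr m_assoc grade_mult)
qed

end

lemma graded_module_direct_sum:
  assumes "graded_algebra K S" and gm: "\<And>i. i \<in> I \<Longrightarrow> graded_module S (M i)"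
  shows "graded_module S (gr_direct_sum I M)"
proof -
  let ?D = "gr_direct_sum I M"
  interpret S: graded_algebra K S by fact
  interpret RS: graded_module S "regular S" by (rule S.graded_module_regular)
  note ds = gr_direct_sum_simps
  have ag: "abelian_group (M i)" if "i \<in> I" for i
    using gm[OF that] by (simp add: graded_module_def)
  have am: "abelian_monoid (M i)" if "i \<in> I" for i
    using ag[OF that] by (simp add: abelian_group_def)
  have neg0: "\<ominus>\<^bsub>M i\<^esub> \<zero>\<^bsub>M i\<^esub> = \<zero>\<^bsub>M i\<^esub>" if "i \<in> I" for i
    using abelian_group.minus_equality[OF ag[OF that]] am[OF that]
    by (simp add: abelian_monoid.l_zero abelian_monoid.zero_closed)
  have cl: "(\<lambda>i\<in>I. h i) \<in> carrier ?D"
    if "\<And>i. i \<in> I \<Longrightarrow> h i \<in> carrier (M i)" "finite A" "\<And>i. i \<in> I \<Longrightarrow> i \<notin> A \<Longrightarrow> h i = \<zero>\<^bsub>M i\<^esub>" for h A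
  proof -
    have "{i \<in> I. (\<lambda>i\<in>I. h i) i \<noteq> \<zero>\<^bsub>M i\<^esub>} \<subseteq> A" using that(3) by auto
    then have "finite {i \<in> I. (\<lambda>i\<in>I. h i) i \<noteq> \<zero>\<^bsub>M i\<^esub>}"
      using that(2) finite_subset by blast
    then show ?thesis using that(1) by (simp only: ds) auto
  qed
  have D: "x i \<in> carrier (M i)" if "x \<in> carrier ?D" "i \<in> I" for x i
    using that by (auto simp: ds)
  have ext: "x \<in> extensional I" if "x \<in> carrier ?D" for x
    using that by (auto simp: ds PiE_def)
  have supp: "finite {i\<in>I. x i \<noteq> \<zero>\<^bsub>M i\<^esub>}" if "x \<in> carrier ?D" for x
    using that by (auto simp: ds)
  have addc: "x \<oplus>\<^bsub>?D\<^esub> y \<in> carrier ?D" if "x \<in> carrier ?D" "y \<in> carrier ?D" for x y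
    unfolding ds(3)
    by (rule cl[of _ "{i\<in>I. x i \<noteq> \<zero>\<^bsub>M i\<^esub>} \<union> {i\<in>I. y i \<noteq> \<zero>\<^bsub>M i\<^esub>}"])
      (use that in \<open>auto simp: D supp am abelian_monoid.a_closed abelian_monoid.l_zero abelian_monoid.zero_closed\<close>)
  have zc: "\<zero>\<^bsub>?D\<^esub> \<in> carrier ?D"
    unfolding ds(2) by (rule cl[of _ "{}"]) (auto simp: am abelian_monoid.zero_closed)
  have negc: "(\<lambda>i\<in>I. \<ominus>\<^bsub>M i\<^esub> x i) \<in> carrier ?D" if "x \<in> carrier ?D" for x
    by (rule cl[of _ "{i\<in>I. x i \<noteq> \<zero>\<^bsub>M i\<^esub>}"])
      (use that in \<open>auto simp: D supp ag abelian_group.a_inv_closed neg0\<close>)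
  have smc: "a \<odot>\<^bsub>?D\<^esub> x \<in> carrier ?D" if "a \<in> carrier S" "x \<in> carrier ?D" for a x
    unfolding ds(4)
    by (rule cl[of _ "{i\<in>I. x i \<noteq> \<zero>\<^bsub>M i\<^esub>}"])
      (use that in \<open>auto simp: D supp gm graded_module.smult_closed[OF gm] graded_module.smult_zero[OF gm]\<close>)
  interpret T: abelian_group ?D
  proof (rule abelian_groupI)
    fix x y z assume x: "x \<in> carrier ?D" and y: "y \<in> carrier ?D" and z: "z \<in> carrier ?D"
    show "x \<oplus>\<^bsub>?D\<^esub> y \<oplus>\<^bsub>?D\<^esub> z = x \<oplus>\<^bsub>?D\<^esub> (y \<oplus>\<^bsub>?D\<^esub> z)"
      using x y z by (auto simp: ds(3) D am abelian_monoid.a_assoc intro!: restrict_ext)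
  next
    fix x y assume x: "x \<in> carrier ?D" and y: "y \<in> carrier ?D"
    show "x \<oplus>\<^bsub>?D\<^esub> y = y \<oplus>\<^bsub>?D\<^esub> x"
      using x y by (auto simp: ds(3) D am abelian_monoid.a_comm intro!: restrict_ext)
  next
    fix x assume x: "x \<in> carrier ?D"
    show "\<zero>\<^bsub>?D\<^esub> \<oplus>\<^bsub>?D\<^esub> x = x"
      by (rule extensionalityI[of _ I]) (use x in \<open>auto simp: ds(2,3) ext D am abelian_monoid.l_zero\<close>)
    show "\<exists>y\<in>carrier ?D. y \<oplus>\<^bsub>?D\<^esub> x = \<zero>\<^bsub>?D\<^esub>"
      by (rule bexI[OF _ negc[OF x]])
        (use x in \<open>auto simp: ds(2,3) D ag abelian_group.l_neg intro!: restrict_ext\<close>)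
  qed (use addc zc in auto)
  have minus: "\<ominus>\<^bsub>?D\<^esub> x = (\<lambda>i\<in>I. \<ominus>\<^bsub>M i\<^esub> x i)" if x: "x \<in> carrier ?D" for x
  proof (rule T.minus_equality)
    show "(\<lambda>i\<in>I. \<ominus>\<^bsub>M i\<^esub> x i) \<oplus>\<^bsub>?D\<^esub> x = \<zero>\<^bsub>?D\<^esub>"
      using x by (auto simp: ds(2,3) D ag abelian_group.l_neg intro!: restrict_ext)
  qed (use x negc in auto)
  have gr: "x \<in> grade ?D \<alpha> \<longleftrightarrow> x \<in> carrier ?D \<and> (\<forall>i\<in>I. x i \<in> grade (M i) \<alpha>)" for x \<alpha>
    using graded_module.grade_closed[OF gm] by (auto simp: ds PiE_iff)
  have fs: "finsum ?D f A i = finsum (M i) (\<lambda>a. f a i) A"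
    if "i \<in> I" "finite A" "\<And>a. a \<in> A \<Longrightarrow> f a \<in> carrier ?D" for i A and f :: "'x \<Rightarrow> _"
    using that(2,3)
  proof (induct A)
    case empty
    then show ?case using that(1)
      by (simp add: T.finsum_empty abelian_monoid.finsum_empty[OF am[OF that(1)]] ds(2))
  next
    case (insert a A)
    have "finsum ?D f (insert a A) = f a \<oplus>\<^bsub>?D\<^esub> finsum ?D f A"
      using insert by (intro T.finsum_insert) auto
    moreover have "finsum (M i) (\<lambda>a. f a i) (insert a A) = f a i \<oplus>\<^bsub>M i\<^esub> finsum (M i) (\<lambda>a. f a i) A"
      using insert that(1) D by (intro abelian_monoid.finsum_insert[OF am]) auto
    ultimately show ?case using insert that(1) by (simp add: ds(3))
  qed
  have ex1: "\<exists>!f. (\<forall>\<alpha>. f \<alpha> \<in> grade ?D \<alpha>) \<and> finite {\<alpha>. f \<alpha> \<noteq> \<zero>\<^bsub>?D\<^esub>} \<and>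
        x = finsum ?D f {\<alpha>. f \<alpha> \<noteq> \<zero>\<^bsub>?D\<^esub>}" (is "\<exists>!f. ?P f")
    if x: "x \<in> carrier ?D" for x
  proof
    let ?c = "\<lambda>i. graded_module.component (M i) (x i)"
    let ?f = "\<lambda>\<alpha>. \<lambda>i\<in>I. ?c i \<alpha>"
    let ?J = "{i\<in>I. x i \<noteq> \<zero>\<^bsub>M i\<^esub>}"
    let ?B = "\<Union>i\<in>?J. {\<alpha>. ?c i \<alpha> \<noteq> \<zero>\<^bsub>M i\<^esub>}"
    have c0: "?c i \<alpha> = \<zero>\<^bsub>M i\<^esub>" if "i \<in> I" "x i = \<zero>\<^bsub>M i\<^esub>" for i \<alpha>
      using graded_module.comp_homogeneous[OF gm, OF that(1) graded_module.zero_grade[OF gm, OF that(1)]]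
        that by simp
    have cg: "?c i \<alpha> \<in> grade (M i) \<alpha>" if "i \<in> I" for i \<alpha>
      using graded_module.comp_grade[OF gm] D[OF x] that by blast
    have cc: "?c i \<alpha> \<in> carrier (M i)" if "i \<in> I" for i \<alpha>
      using graded_module.grade_closed[OF gm] cg that by blast
    have fc: "?f \<alpha> \<in> carrier ?D" for \<alpha>
      by (rule cl[of _ ?J]) (use cc c0 supp[OF x] in auto)
    have fg: "?f \<alpha> \<in> grade ?D \<alpha>" for \<alpha>
      using fc cg by (auto simp: gr)
    have B: "finite ?B"
      using supp[OF x] graded_module.comp_finite[OF gm] D[OF x] by blast
    have sub: "{\<alpha>. ?f \<alpha> \<noteq> \<zero>\<^bsub>?D\<^esub>} \<subseteq> ?B"
    proof safe
      fix \<alpha> assume a: "?f \<alpha> \<noteq> \<zero>\<^bsub>?D\<^esub>"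
      have "\<exists>i\<in>I. ?c i \<alpha> \<noteq> \<zero>\<^bsub>M i\<^esub>"
      proof (rule ccontr)
        assume "\<not> ?thesis"
        then have "?f \<alpha> = \<zero>\<^bsub>?D\<^esub>" by (auto simp: ds(2) intro!: restrict_ext)
        with a show False by simp
      qed
      then show "\<alpha> \<in> ?B" using c0 by blast
    qed
    have fin: "finite {\<alpha>. ?f \<alpha> \<noteq> \<zero>\<^bsub>?D\<^esub>}" using B sub by (rule finite_subset[rotated])
    have "x = finsum ?D ?f {\<alpha>. ?f \<alpha> \<noteq> \<zero>\<^bsub>?D\<^esub>}"
    proof (rule extensionalityI[of _ I])
      fix i assume i: "i \<in> I"
      have "finsum ?D ?f {\<alpha>. ?f \<alpha> \<noteq> \<zero>\<^bsub>?D\<^esub>} i = finsum (M i) (\<lambda>\<alpha>. ?f \<alpha> i) {\<alpha>. ?f \<alpha> \<noteq> \<zero>\<^bsub>?D\<^esub>}"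
        using i fin fc by (rule fs)
      also have "\<dots> = finsum (M i) (?c i) {\<alpha>. ?f \<alpha> \<noteq> \<zero>\<^bsub>?D\<^esub>}" using i by simp
      also have "\<dots> = x i"
      proof (rule graded_module.finsum_comp[OF gm[OF i] D[OF x i] fin])
        fix \<alpha> assume "\<alpha> \<notin> {\<alpha>. ?f \<alpha> \<noteq> \<zero>\<^bsub>?D\<^esub>}"
        then have "?f \<alpha> i = \<zero>\<^bsub>?D\<^esub> i" by simp
        then show "?c i \<alpha> = \<zero>\<^bsub>M i\<^esub>" using i by (simp add: ds(2))
      qed
      finally show "x i = finsum ?D ?f {\<alpha>. ?f \<alpha> \<noteq> \<zero>\<^bsub>?D\<^esub>} i" ..
    qed (use ext x fc in \<open>auto intro!: ext T.finsum_closed\<close>)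
    then show "?P ?f" using fg fin by auto
  next
    fix f assume f: "?P f"
    then have fc: "f \<alpha> \<in> carrier ?D" for \<alpha> by (auto simp: gr)
    show "f = (\<lambda>\<alpha>. \<lambda>i\<in>I. graded_module.component (M i) (x i) \<alpha>)"
    proof (rule HOL.ext)
      fix \<alpha>
      show "f \<alpha> = (\<lambda>i\<in>I. graded_module.component (M i) (x i) \<alpha>)"
      proof (rule extensionalityI[of _ I])
        fix i assume i: "i \<in> I"
        have "graded_module.component (M i) (x i) = (\<lambda>\<alpha>. f \<alpha> i)"
        proof (rule graded_module.comp_eqI[OF gm[OF i], of _ "{\<alpha>. f \<alpha> \<noteq> \<zero>\<^bsub>?D\<^esub>}"])
          have "x i = finsum ?D f {\<alpha>. f \<alpha> \<noteq> \<zero>\<^bsub>?D\<^esub>} i" using f by metis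
          then show "x i = finsum (M i) (\<lambda>\<alpha>. f \<alpha> i) {\<alpha>. f \<alpha> \<noteq> \<zero>\<^bsub>?D\<^esub>}"
            using f fc i by (subst fs[symmetric]) auto
        qed (use f i in \<open>auto simp: gr ds(2)\<close>)
        then show "f \<alpha> i = (\<lambda>i\<in>I. graded_module.component (M i) (x i) \<alpha>) i" using i by simp
      qed (use ext fc in auto)
    qed
  qed
  have "additive_subgroup (grade ?D \<alpha>) ?D" for \<alpha>
    unfolding additive_subgroup_iff[OF T.abelian_group_axioms]
    using zc addc negc
    by (auto simp: gr minus subset_iff)
      (auto simp: ds(2,3) gm graded_module.zero_grade[OF gm] graded_module.add_grade[OF gm] graded_module.minus_grade[OF gm])
  with ex1 have gd: "is_grading ?D" unfolding is_grading_def by blast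
  show ?thesis
  proof
    fix a b x y assume a: "a \<in> carrier S" and x: "x \<in> carrier ?D"
    show "a \<odot>\<^bsub>?D\<^esub> x \<in> carrier ?D" using smc a x .
    show "(a \<oplus>\<^bsub>S\<^esub> b) \<odot>\<^bsub>?D\<^esub> x = a \<odot>\<^bsub>?D\<^esub> x \<oplus>\<^bsub>?D\<^esub> b \<odot>\<^bsub>?D\<^esub> x" if "b \<in> carrier S"
      using a x that D by (auto simp: ds(3,4) gm graded_module.smult_l_distr[OF gm] intro!: restrict_ext)
    show "(a \<otimes>\<^bsub>S\<^esub> b) \<odot>\<^bsub>?D\<^esub> x = a \<odot>\<^bsub>?D\<^esub> (b \<odot>\<^bsub>?D\<^esub> x)" if "b \<in> carrier S"
      using a x that D by (auto simp: ds(4) gm graded_module.smult_assoc[OF gm] intro!: restrict_ext)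
    show "a \<odot>\<^bsub>?D\<^esub> (x \<oplus>\<^bsub>?D\<^esub> y) = a \<odot>\<^bsub>?D\<^esub> x \<oplus>\<^bsub>?D\<^esub> a \<odot>\<^bsub>?D\<^esub> y" if "y \<in> carrier ?D"
      using a x that D by (auto simp: ds(3,4) gm graded_module.smult_r_distr[OF gm] intro!: restrict_ext)
  next
    fix x assume x: "x \<in> carrier ?D"
    show "\<one>\<^bsub>S\<^esub> \<odot>\<^bsub>?D\<^esub> x = x"
      by (rule extensionalityI[of _ I]) (use x ext D in \<open>auto simp: ds(4) gm graded_module.smult_one[OF gm]\<close>)
  next
    fix a x \<alpha> \<beta> assume ax: "a \<in> grade S \<alpha>" "x \<in> grade ?D \<beta>"
    have "a \<in> carrier S" using RS.grade_closed ax(1) by simp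
    then show "a \<odot>\<^bsub>?D\<^esub> x \<in> grade ?D (\<alpha> + \<beta>)"
      using ax smc[of a x] by (auto simp: gr) (auto simp: ds(4) gm graded_module.grade_smult[OF gm])
  qed (fact gd)
qed


text \<open>The universal property of the graded free module on homogeneous generators of degrees \<open>d i\<close>.\<close>

definition free_map :: "'i set \<Rightarrow> ('i \<Rightarrow> 'm) \<Rightarrow> ('g, 'k, 's) gmodule \<Rightarrow> ('g, 's, 'm) gmodule \<Rightarrow>
    ('i \<Rightarrow> 's) \<Rightarrow> 'm" where
  "free_map I m S M c = finsum M (\<lambda>i. c i \<odot>\<^bsub>M\<^esub> m i) {i\<in>I. c i \<noteq> \<zero>\<^bsub>S\<^esub>}"

lemma free_map_hom:
  assumes "graded_algebra K S" "graded_module S M" and m: "\<And>i. i \<in> I \<Longrightarrow> m i \<in> grade M (d i)"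
  shows "free_map I m S M \<in> gr_hom S (gr_direct_sum I (\<lambda>i. twist (regular S) (- d i))) M"
proof -
  interpret S: graded_algebra K S by fact
  interpret RS: graded_module S "regular S" by (rule S.graded_module_regular)
  interpret M: graded_module S M by fact
  let ?F = "gr_direct_sum I (\<lambda>i. twist (regular S) (- d i))"
  interpret F: graded_module S ?F
    by (rule graded_module_direct_sum[OF assms(1)]) (rule RS.graded_module_twist)
  note ds = gr_direct_sum_simps
  have mc: "m i \<in> carrier M" if "i \<in> I" for i using m[OF that] by (rule M.grade_closed)
  have cc: "c i \<in> carrier S" if "c \<in> carrier ?F" "i \<in> I" for c i using that by (auto simp: ds)
  have ext: "free_map I m S M c = finsum M (\<lambda>i. c i \<odot>\<^bsub>M\<^esub> m i) B"
    if "c \<in> carrier ?F" "finite B" "B \<subseteq> I" "{i\<in>I. c i \<noteq> \<zero>\<^bsub>S\<^esub>} \<subseteq> B" for c B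
    unfolding free_map_def
    using that cc mc by (intro M.finsum_extend) (auto simp: M.zero_smult intro!: M.smult_closed)
  have supp: "finite {i\<in>I. c i \<noteq> \<zero>\<^bsub>S\<^esub>}" if "c \<in> carrier ?F" for c
    using that by (auto simp: ds)
  have cl: "free_map I m S M c \<in> carrier M" if "c \<in> carrier ?F" for c
    unfolding free_map_def using that cc mc by (intro M.M.finsum_closed) (auto intro!: M.smult_closed)
  have add: "free_map I m S M (x \<oplus>\<^bsub>?F\<^esub> y) = free_map I m S M x \<oplus>\<^bsub>M\<^esub> free_map I m S M y"
    if x: "x \<in> carrier ?F" and y: "y \<in> carrier ?F" for x y
  proof -
    let ?B = "{i\<in>I. x i \<noteq> \<zero>\<^bsub>S\<^esub>} \<union> {i\<in>I. y i \<noteq> \<zero>\<^bsub>S\<^esub>}"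
    have B: "finite ?B" "?B \<subseteq> I" using supp x y by auto
    have "free_map I m S M (x \<oplus>\<^bsub>?F\<^esub> y) = finsum M (\<lambda>i. (x \<oplus>\<^bsub>?F\<^esub> y) i \<odot>\<^bsub>M\<^esub> m i) ?B"
      using B x y by (intro ext F.M.a_closed) (auto simp: ds)
    also have "\<dots> = finsum M (\<lambda>i. x i \<odot>\<^bsub>M\<^esub> m i \<oplus>\<^bsub>M\<^esub> y i \<odot>\<^bsub>M\<^esub> m i) ?B"
      using x y cc mc by (intro M.M.finsum_cong') (auto simp: ds(3) M.smult_l_distr intro!: M.smult_closed)
    also have "\<dots> = finsum M (\<lambda>i. x i \<odot>\<^bsub>M\<^esub> m i) ?B \<oplus>\<^bsub>M\<^esub> finsum M (\<lambda>i. y i \<odot>\<^bsub>M\<^esub> m i) ?B"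
      using x y cc mc by (intro M.M.finsum_addf) (auto intro!: M.smult_closed)
    also have "\<dots> = free_map I m S M x \<oplus>\<^bsub>M\<^esub> free_map I m S M y"
      using ext[OF x B] ext[OF y B] by auto
    finally show ?thesis .
  qed
  have sm: "free_map I m S M (a \<odot>\<^bsub>?F\<^esub> x) = a \<odot>\<^bsub>M\<^esub> free_map I m S M x"
    if x: "x \<in> carrier ?F" and a: "a \<in> carrier S" for a x
  proof -
    let ?B = "{i\<in>I. x i \<noteq> \<zero>\<^bsub>S\<^esub>}"
    have B: "finite ?B" "?B \<subseteq> I" using supp x by auto
    have "free_map I m S M (a \<odot>\<^bsub>?F\<^esub> x) = finsum M (\<lambda>i. (a \<odot>\<^bsub>?F\<^esub> x) i \<odot>\<^bsub>M\<^esub> m i) ?B"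
      using B x a by (intro ext F.smult_closed) (auto simp: ds)
    also have "\<dots> = finsum M (\<lambda>i. a \<odot>\<^bsub>M\<^esub> (x i \<odot>\<^bsub>M\<^esub> m i)) ?B"
      using x a cc mc by (intro M.M.finsum_cong') (auto simp: ds(4) M.smult_assoc intro!: M.smult_closed)
    also have "\<dots> = a \<odot>\<^bsub>M\<^esub> free_map I m S M x"
      unfolding free_map_def
      using x a cc mc by (intro M.smult_finsum[symmetric]) (auto intro!: M.smult_closed)
    finally show ?thesis .
  qed
  have gr: "free_map I m S M x \<in> grade M \<beta>" if x: "x \<in> grade ?F \<beta>" for x \<beta>
    unfolding free_map_def
  proof (rule M.finsum_grade)
    fix i assume i: "i \<in> {i\<in>I. x i \<noteq> \<zero>\<^bsub>S\<^esub>}"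
    then have "x i \<in> grade S (- d i + \<beta>)" using x by (auto simp: ds)
    then have "x i \<odot>\<^bsub>M\<^esub> m i \<in> grade M (- d i + \<beta> + d i)"
      using m i by (intro M.grade_smult) auto
    then show "x i \<odot>\<^bsub>M\<^esub> m i \<in> grade M \<beta>" by simp
  qed
  show ?thesis using cl add sm gr by (auto simp: gr_hom_def hom_def)
qed

lemma gr_homD:
  assumes "f \<in> gr_hom S M N"
  shows "x \<in> carrier M \<Longrightarrow> f x \<in> carrier N"
    and "x \<in> carrier M \<Longrightarrow> y \<in> carrier M \<Longrightarrow> f (x \<oplus>\<^bsub>M\<^esub> y) = f x \<oplus>\<^bsub>N\<^esub> f y"
    and "a \<in> carrier S \<Longrightarrow> x \<in> carrier M \<Longrightarrow> f (a \<odot>\<^bsub>M\<^esub> x) = a \<odot>\<^bsub>N\<^esub> f x"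
    and "x \<in> grade M \<alpha> \<Longrightarrow> f x \<in> grade N \<alpha>"
  using assms by (auto simp: gr_hom_def hom_def)

lemma gr_hom_comp:
  assumes "f \<in> gr_hom S L M" "g \<in> gr_hom S M N"
  shows "(\<lambda>x. g (f x)) \<in> gr_hom S L N"
  using assms by (auto simp: gr_hom_def hom_def Pi_iff)

lemma gr_hom_zero:
  assumes "graded_module S M" "graded_module S N" "f \<in> gr_hom S M N"
  shows "f \<zero>\<^bsub>M\<^esub> = \<zero>\<^bsub>N\<^esub>"
proof -
  interpret M: graded_module S M by fact
  interpret N: graded_module S N by fact
  have "f \<zero>\<^bsub>M\<^esub> = f \<zero>\<^bsub>M\<^esub> \<oplus>\<^bsub>N\<^esub> f \<zero>\<^bsub>M\<^esub>"
    using gr_homD(2)[OF assms(3), of "\<zero>\<^bsub>M\<^esub>" "\<zero>\<^bsub>M\<^esub>"] by simp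
  then show ?thesis
    using gr_homD(1)[OF assms(3), of "\<zero>\<^bsub>M\<^esub>"] by (metis M.M.zero_closed N.M.add.l_cancel_one)
qed

lemma gr_hom_finsum:
  assumes "graded_module S M" "graded_module S N" "f \<in> gr_hom S M N"
    and "\<And>i. i \<in> A \<Longrightarrow> u i \<in> carrier M"
  shows "f (finsum M u A) = (\<Oplus>\<^bsub>N\<^esub>i\<in>A. f (u i))"
proof -
  interpret M: graded_module S M by fact
  interpret N: graded_module S N by fact
  show ?thesis using assms(4)
  proof (induct A rule: infinite_finite_induct)
    case (insert a A)
    then show ?case
      using gr_homD[OF assms(3)]
      by (subst M.M.finsum_insert, simp, simp, simp add: Pi_iff, simp,
          subst N.M.finsum_insert) (auto simp: Pi_iff)
  qed (use gr_hom_zero[OF assms(1-3)] in auto)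
qed

lemma free_map_comp:
  assumes "graded_algebra K S" "graded_module S M" "graded_module S N" "g \<in> gr_hom S M N"
    and m: "\<And>i. i \<in> I \<Longrightarrow> m i \<in> carrier M"
    and c: "c \<in> I \<rightarrow> carrier S"
  shows "g (free_map I m S M c) = free_map I (\<lambda>i. g (m i)) S N c"
proof -
  interpret M: graded_module S M by fact
  interpret N: graded_module S N by fact
  have "g (free_map I m S M c) = (\<Oplus>\<^bsub>N\<^esub>i\<in>{i\<in>I. c i \<noteq> \<zero>\<^bsub>S\<^esub>}. g (c i \<odot>\<^bsub>M\<^esub> m i))"
    unfolding free_map_def using m c
    by (intro gr_hom_finsum[OF assms(2-4)]) (auto intro!: M.smult_closed)
  also have "\<dots> = free_map I (\<lambda>i. g (m i)) S N c"
    unfolding free_map_def using m c gr_homD[OF assms(4)]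
    by (intro N.M.finsum_cong') (auto simp: Pi_iff intro!: N.smult_closed)
  finally show ?thesis .
qed

lemma gr_surj_grade:
  assumes "graded_module S M" "graded_module S N" "g \<in> gr_hom S M N" "g ` carrier M = carrier N"
    and y: "y \<in> grade N \<alpha>"
  shows "\<exists>x\<in>grade M \<alpha>. g x = y"
proof -
  interpret M: graded_module S M by fact
  interpret N: graded_module S N by fact
  note g = gr_homD[OF assms(3)]
  obtain x where x: "x \<in> carrier M" "g x = y"
    using N.grade_closed[OF y] assms(4) by (metis imageE)
  have "N.component y = (\<lambda>\<alpha>. g (M.component x \<alpha>))"
  proof (rule N.comp_eqI[of _ "{\<alpha>. M.component x \<alpha> \<noteq> \<zero>\<^bsub>M\<^esub>}"])
    have "g (finsum M (M.component x) {\<alpha>. M.component x \<alpha> \<noteq> \<zero>\<^bsub>M\<^esub>}) =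
        (\<Oplus>\<^bsub>N\<^esub>\<alpha>\<in>{\<alpha>. M.component x \<alpha> \<noteq> \<zero>\<^bsub>M\<^esub>}. g (M.component x \<alpha>))"
      using x by (intro gr_hom_finsum[OF assms(1-3)]) (auto intro: M.grade_closed M.comp_grade)
    then show "y = (\<Oplus>\<^bsub>N\<^esub>\<alpha>\<in>{\<alpha>. M.component x \<alpha> \<noteq> \<zero>\<^bsub>M\<^esub>}. g (M.component x \<alpha>))"
      using x M.finsum_comp[OF x(1) M.comp_finite[OF x(1)]] by auto
  qed (use x M.comp_grade M.comp_finite g gr_hom_zero[OF assms(1-3)] in auto)
  then have "g (M.component x \<alpha>) = y"
    using N.comp_homogeneous[OF y] by (metis (no_types, lifting))
  then show ?thesis using M.comp_grade[OF x(1)] by blast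
qed

theorem gr_projective_lift:
  fixes P :: "('g::ab_group_add, 's, 'p) gmodule" and M :: "('g, 's, 'm) gmodule"
    and N :: "('g, 's, 'n) gmodule"
  assumes "graded_algebra K S" "gr_projective S P"
    and M: "graded_module S M" and N: "graded_module S N"
    and g: "g \<in> gr_hom S M N" and surj: "g ` carrier M = carrier N"
    and f: "f \<in> gr_hom S P N"
  shows "\<exists>h\<in>gr_hom S P M. \<forall>x\<in>carrier P. g (h x) = f x"
proof -
  interpret S: graded_algebra K S by fact
  interpret RS: graded_module S "regular S" by (rule S.graded_module_regular)
  have P: "graded_module S P" using assms(2) by (simp add: gr_projective_def)
  interpret P: graded_module S P by fact
  interpret M: graded_module S M by fact
  interpret N: graded_module S N by fact
  define I where "I = (\<Union>\<alpha>. grade P \<alpha>)"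
  define d where "d = (\<lambda>x. SOME \<alpha>. x \<in> grade P \<alpha>)"
  have d: "x \<in> grade P (d x)" if "x \<in> I" for x
    using that unfolding I_def d_def by (auto intro: someI)
  have Ic: "x \<in> carrier P" if "x \<in> I" for x using d[OF that] by (rule P.grade_closed)
  let ?F = "gr_direct_sum I (\<lambda>i. twist (regular S) (- d i))"
  note ds = gr_direct_sum_simps
  have F: "graded_module S ?F"
    by (rule graded_module_direct_sum[OF assms(1)]) (rule RS.graded_module_twist)
  interpret F: graded_module S ?F by (rule F)
  let ?\<pi> = "free_map I (\<lambda>x. x) S P"
  have \<pi>: "?\<pi> \<in> gr_hom S ?F P" by (rule free_map_hom[OF assms(1) P d])
  have gen: "x \<in> ?\<pi> ` carrier ?F" if x: "x \<in> I" for x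
  proof
    let ?e = "\<lambda>i\<in>I. if i = x then \<one>\<^bsub>S\<^esub> else \<zero>\<^bsub>S\<^esub>"
    have sub: "{i\<in>I. ?e i \<noteq> \<zero>\<^bsub>S\<^esub>} \<subseteq> {x}" by auto
    then have "finite {i\<in>I. ?e i \<noteq> \<zero>\<^bsub>S\<^esub>}" by (rule finite_subset) simp
    then show "?e \<in> carrier ?F" by (simp only: ds) auto
    have "?\<pi> ?e = finsum P (\<lambda>i. ?e i \<odot>\<^bsub>P\<^esub> i) {x}"
      unfolding free_map_def using x Ic sub
      by (intro P.finsum_extend) (auto simp: P.zero_smult intro!: P.smult_closed)
    also have "\<dots> = x" using x Ic[OF x] by (subst P.M.finsum_insert) (auto simp: P.smult_one)
    finally show "x = ?\<pi> ?e" ..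
  qed
  have "?\<pi> ` carrier ?F = carrier P"
  proof
    show "?\<pi> ` carrier ?F \<subseteq> carrier P" using gr_homD(1)[OF \<pi>] by blast
    show "carrier P \<subseteq> ?\<pi> ` carrier ?F"
    proof
      fix x assume x: "x \<in> carrier P"
      have "P.component x \<alpha> \<in> ?\<pi> ` carrier ?F" for \<alpha>
        using gen P.comp_grade[OF x] by (auto simp: I_def)
      then obtain u where u: "u \<alpha> \<in> carrier ?F" "?\<pi> (u \<alpha>) = P.component x \<alpha>" for \<alpha>
        unfolding image_iff by metis
      have "?\<pi> (finsum ?F u {\<alpha>. P.component x \<alpha> \<noteq> \<zero>\<^bsub>P\<^esub>}) = finsum P (P.component x) {\<alpha>. P.component x \<alpha> \<noteq> \<zero>\<^bsub>P\<^esub>}"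
        using gr_hom_finsum[OF F P \<pi>, of _ u] u by simp
      also have "\<dots> = x" using x by (intro P.finsum_comp P.comp_finite) auto
      finally have eq: "?\<pi> (finsum ?F u {\<alpha>. P.component x \<alpha> \<noteq> \<zero>\<^bsub>P\<^esub>}) = x" .
      have "finsum ?F u {\<alpha>. P.component x \<alpha> \<noteq> \<zero>\<^bsub>P\<^esub>} \<in> carrier ?F"
        by (rule F.M.finsum_closed, rule Pi_I, rule u(1))
      from imageI[OF this, of ?\<pi>] show "x \<in> ?\<pi> ` carrier ?F" unfolding eq .
    qed
  qed
  moreover have id: "(\<lambda>x. x) \<in> gr_hom S P P" by (auto simp: gr_hom_def hom_def)
  ultimately have "\<exists>s\<in>gr_hom S P ?F. \<forall>x\<in>carrier P. ?\<pi> (s x) = x"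
    using assms(2)[unfolded gr_projective_def, THEN conjunct2, rule_format, OF \<pi> id] F P by simp
  then obtain s where s: "s \<in> gr_hom S P ?F" "\<And>x. x \<in> carrier P \<Longrightarrow> ?\<pi> (s x) = x" by blast
  have "\<forall>x\<in>I. \<exists>y\<in>grade M (d x). g y = f x"
    using gr_surj_grade[OF M N g surj] gr_homD(4)[OF f] d by blast
  then obtain m where m: "\<And>x. x \<in> I \<Longrightarrow> m x \<in> grade M (d x)" "\<And>x. x \<in> I \<Longrightarrow> g (m x) = f x"
    by metis
  let ?h = "\<lambda>x. free_map I m S M (s x)"
  have "?h \<in> gr_hom S P M" by (rule gr_hom_comp[OF s(1) free_map_hom[OF assms(1) M m(1)]])
  moreover have "g (?h x) = f x" if x: "x \<in> carrier P" for x
  proof -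
    have sx: "s x \<in> I \<rightarrow> carrier S" using gr_homD(1)[OF s(1) x] by (auto simp: ds)
    have "g (?h x) = free_map I (\<lambda>i. g (m i)) S N (s x)"
      using M.grade_closed m(1) sx by (intro free_map_comp[OF assms(1) M N g]) auto
    also have "\<dots> = free_map I f S N (s x)"
      unfolding free_map_def using m(2) sx gr_homD(1)[OF f] Ic
      by (intro N.M.finsum_cong') (auto simp: Pi_iff intro!: N.smult_closed)
    also have "\<dots> = f (?\<pi> (s x))"
      using free_map_comp[OF assms(1) P N f, of I "\<lambda>x. x" "s x"] Ic sx by simp
    finally show ?thesis unfolding s(2)[OF x] .
  qed
  ultimately show ?thesis by (intro bexI[of _ ?h]) auto
qed

end

theory Submission
  imports Defs "HOL.Hull"
begin

text \<open>
  If \<open>x \<in> S\<^sub>\<alpha>\<close>, \<open>y \<in> S\<^sub>-\<^sub>\<alpha>\<close> with \<open>\<alpha> \<noteq> 0\<close>, then \<open>x y = 0\<close>, since otherwise \<open>x\<close> would be a homogeneous unit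
  of nonzero degree. Hence taking degree 0 parts is multiplicative, and \<open>\<mm>\<close> is its kernel. For
  modules the grading replaces the usual Nakayama argument: in a homogeneous expression of a
  generator \<open>g\<close> with coefficients in \<open>\<mm>\<close>, the coefficient of \<open>g\<close> itself has degree 0, so it is
  0 and \<open>g\<close> is redundant. A minimal system of homogeneous generators of a projective module \<open>P\<close>
  gives a split surjection \<open>F \<rightarrow> P\<close> with kernel inside \<open>\<mm>F\<close>, so by Nakayama the splitting is
  onto. The multiplicity of each twist in a free module \<open>F\<close> is the dimension over \<open>S\<^sub>0\<close> of a graded
  piece of \<open>F/\<mm>F\<close>.
\<close>

subsection \<open>Homogeneous components and submodules\<close>

text \<open>No finiteness of \<open>A\<close> is assumed: a sum over an infinite set is zero by
  convention, and zero lies in every subgroup.\<close>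

lemma (in abelian_group) subgroup_finsum:
  assumes H: "subgroup H (add_monoid G)" and "\<And>i. i \<in> A \<Longrightarrow> f i \<in> H"
  shows "finsum G f A \<in> H"
  using assms(2)
proof (induct A rule: infinite_finite_induct)
  case (insert a A)
  moreover have "f a \<in> carrier G" "f \<in> A \<rightarrow> carrier G"
    using subgroup.subset[OF H] insert by auto
  ultimately show ?case
    using subgroup.m_closed[OF H] by (subst finsum_insert) auto
qed (use subgroup.one_closed[OF H] in auto)

context graded_module
begin

lemma comp_closed: "x \<in> carrier M \<Longrightarrow> component x \<alpha> \<in> carrier M"
  using comp_grade grade_closed by blast

lemma comp_zero [simp]: "component \<zero>\<^bsub>M\<^esub> \<alpha> = \<zero>\<^bsub>M\<^esub>"
  using comp_homogeneous[OF zero_grade] by simp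

text \<open>The degreewise sum of the two decompositions is a decomposition of the sum, and
  decompositions are unique. The union of the supports serves as a common finite index set.\<close>

lemma comp_add:
  assumes x: "x \<in> carrier M" and y: "y \<in> carrier M"
  shows "component (x \<oplus>\<^bsub>M\<^esub> y) \<alpha> = component x \<alpha> \<oplus>\<^bsub>M\<^esub> component y \<alpha>"
proof -
  let ?B = "{\<alpha>. component x \<alpha> \<noteq> \<zero>\<^bsub>M\<^esub>} \<union> {\<alpha>. component y \<alpha> \<noteq> \<zero>\<^bsub>M\<^esub>}"
  have B: "finite ?B" using comp_finite x y by blast
  have "component (x \<oplus>\<^bsub>M\<^esub> y) = (\<lambda>\<alpha>. component x \<alpha> \<oplus>\<^bsub>M\<^esub> component y \<alpha>)"
  proof (rule comp_eqI[OF _ B])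
    have "(\<Oplus>\<^bsub>M\<^esub>\<alpha>\<in>?B. component x \<alpha> \<oplus>\<^bsub>M\<^esub> component y \<alpha>) = finsum M (component x) ?B \<oplus>\<^bsub>M\<^esub> finsum M (component y) ?B"
      by (rule M.finsum_addf) (auto intro: comp_closed x y)
    also have "\<dots> = x \<oplus>\<^bsub>M\<^esub> y"
      using finsum_comp[OF x B] finsum_comp[OF y B] by simp
    finally show "x \<oplus>\<^bsub>M\<^esub> y = (\<Oplus>\<^bsub>M\<^esub>\<alpha>\<in>?B. component x \<alpha> \<oplus>\<^bsub>M\<^esub> component y \<alpha>)" ..
  qed (auto intro: add_grade comp_grade x y)
  then show ?thesis by simp
qed

lemma comp_finsum:
  assumes "\<And>i. i \<in> A \<Longrightarrow> f i \<in> carrier M"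
  shows "component (finsum M f A) \<alpha> = (\<Oplus>\<^bsub>M\<^esub>i\<in>A. component (f i) \<alpha>)"
  using assms
proof (induct A rule: infinite_finite_induct)
  case (insert a A)
  then show ?case
    by (subst (1 2) M.finsum_insert) (auto simp: comp_add comp_closed)
qed auto

text \<open>A homogeneous scalar of degree \<delta> shifts a decomposition by \<delta>, and
  uniqueness does the rest. Membership of \<open>a\<close> in the carrier is a separate hypothesis
  because \<open>graded_module\<close> does not record that the pieces of \<open>S\<close> lie in
  its carrier.\<close>

lemma comp_smult_homogeneous:
  assumes a: "a \<in> carrier S" "a \<in> grade S \<delta>" and x: "x \<in> carrier M"
  shows "component (a \<odot>\<^bsub>M\<^esub> x) \<alpha> = a \<odot>\<^bsub>M\<^esub> component x (\<alpha> - \<delta>)"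
proof -
  let ?B = "{\<alpha>. component x \<alpha> \<noteq> \<zero>\<^bsub>M\<^esub>}"
  have "component (a \<odot>\<^bsub>M\<^esub> x) = (\<lambda>\<alpha>. a \<odot>\<^bsub>M\<^esub> component x (\<alpha> - \<delta>))"
  proof (rule comp_eqI)
    show "a \<odot>\<^bsub>M\<^esub> component x (\<alpha> - \<delta>) \<in> grade M \<alpha>" for \<alpha>
      using grade_smult[OF a(2) comp_grade[OF x, of "\<alpha> - \<delta>"]] by simp
    show "finite ((+) \<delta> ` ?B)" using comp_finite[OF x] by blast
    show "a \<odot>\<^bsub>M\<^esub> component x (\<alpha> - \<delta>) = \<zero>\<^bsub>M\<^esub>" if "\<alpha> \<notin> (+) \<delta> ` ?B" for \<alpha>
    proof -
      have "component x (\<alpha> - \<delta>) = \<zero>\<^bsub>M\<^esub>"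
        using that by (metis (mono_tags, lifting) add.commute diff_add_cancel image_eqI mem_Collect_eq)
      then show ?thesis using smult_zero[OF a(1)] by simp
    qed
    have "a \<odot>\<^bsub>M\<^esub> x = (\<Oplus>\<^bsub>M\<^esub>\<alpha>\<in>?B. a \<odot>\<^bsub>M\<^esub> component x \<alpha>)"
      using finsum_comp[OF x comp_finite[OF x]] smult_finsum[OF a(1), of "component x" ?B] comp_closed[OF x] by auto
    also have "\<dots> = (\<Oplus>\<^bsub>M\<^esub>\<alpha>\<in>(+) \<delta> ` ?B. a \<odot>\<^bsub>M\<^esub> component x (\<alpha> - \<delta>))"
      by (subst M.finsum_reindex) (auto intro!: smult_closed comp_closed a x)
    finally show "a \<odot>\<^bsub>M\<^esub> x = (\<Oplus>\<^bsub>M\<^esub>\<alpha>\<in>(+) \<delta> ` ?B. a \<odot>\<^bsub>M\<^esub> component x (\<alpha> - \<delta>))" .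
  qed
  then show ?thesis by simp
qed

text \<open>Stated as a predicate on sets so that \<open>is_submodule hull G\<close> is the
  submodule generated by \<open>G\<close>. Negatives come from the scalar -1. Submodules need not be
  graded; where gradedness matters, closure under components is demanded separately.\<close>

definition is_submodule :: "'m set \<Rightarrow> bool" where
  "is_submodule L \<longleftrightarrow> L \<subseteq> carrier M \<and> \<zero>\<^bsub>M\<^esub> \<in> L \<and>
     (\<forall>x\<in>L. \<forall>y\<in>L. x \<oplus>\<^bsub>M\<^esub> y \<in> L) \<and> (\<forall>a\<in>carrier S. \<forall>x\<in>L. a \<odot>\<^bsub>M\<^esub> x \<in> L)"

lemma is_submoduleI:
  assumes "L \<subseteq> carrier M" "\<zero>\<^bsub>M\<^esub> \<in> L"
    and "\<And>x y. x \<in> L \<Longrightarrow> y \<in> L \<Longrightarrow> x \<oplus>\<^bsub>M\<^esub> y \<in> L"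
    and "\<And>a x. a \<in> carrier S \<Longrightarrow> x \<in> L \<Longrightarrow> a \<odot>\<^bsub>M\<^esub> x \<in> L"
  shows "is_submodule L"
  using assms by (simp add: is_submodule_def)

lemma is_submoduleD:
  assumes "is_submodule L"
  shows "L \<subseteq> carrier M" "\<zero>\<^bsub>M\<^esub> \<in> L"
    and "x \<in> L \<Longrightarrow> y \<in> L \<Longrightarrow> x \<oplus>\<^bsub>M\<^esub> y \<in> L"
    and "a \<in> carrier S \<Longrightarrow> x \<in> L \<Longrightarrow> a \<odot>\<^bsub>M\<^esub> x \<in> L"
  using assms by (auto simp: is_submodule_def)

lemma smult_minus_one:
  assumes "x \<in> carrier M"
  shows "(\<ominus>\<^bsub>S\<^esub> \<one>\<^bsub>S\<^esub>) \<odot>\<^bsub>M\<^esub> x = \<ominus>\<^bsub>M\<^esub> x"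
proof -
  have "(\<ominus>\<^bsub>S\<^esub> \<one>\<^bsub>S\<^esub>) \<odot>\<^bsub>M\<^esub> x \<oplus>\<^bsub>M\<^esub> x = (\<ominus>\<^bsub>S\<^esub> \<one>\<^bsub>S\<^esub> \<oplus>\<^bsub>S\<^esub> \<one>\<^bsub>S\<^esub>) \<odot>\<^bsub>M\<^esub> x"
    using assms by (simp add: smult_l_distr smult_one)
  also have "\<dots> = \<zero>\<^bsub>M\<^esub>" using assms by (simp add: R.l_neg zero_smult)
  finally show ?thesis
    using assms by (metis M.minus_equality R.a_inv_closed R.one_closed smult_closed)
qed

lemma is_submodule_minus: "is_submodule L \<Longrightarrow> x \<in> L \<Longrightarrow> \<ominus>\<^bsub>M\<^esub> x \<in> L"
  unfolding is_submodule_def using smult_minus_one by (metis R.a_inv_closed R.one_closed subset_iff)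

lemma is_submodule_subgroup:
  assumes "is_submodule L"
  shows "subgroup L (add_monoid M)"
  using assms is_submodule_minus[OF assms]
  by (auto simp: is_submodule_def subgroup_def a_inv_def)

lemma is_submodule_finsum:
  "is_submodule L \<Longrightarrow> (\<And>i. i \<in> A \<Longrightarrow> f i \<in> L) \<Longrightarrow> finsum M f A \<in> L"
  by (rule M.subgroup_finsum[OF is_submodule_subgroup])

lemma is_submodule_carrier: "is_submodule (carrier M)"
  by (auto simp: is_submodule_def smult_closed)

lemma is_submodule_hull:
  assumes "G \<subseteq> carrier M"
  shows "is_submodule (is_submodule hull G)"
proof -
  \<comment> \<open>The carrier is one of the submodules being intersected, which bounds the
    hull.\<close>
  have "is_submodule hull G \<subseteq> carrier M"
    using assms is_submodule_carrier by (rule hull_minimal)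
  then show ?thesis
    by (subst is_submodule_def) (auto simp: hull_def is_submodule_def)
qed

lemma zero_submodule: "is_submodule {\<zero>\<^bsub>M\<^esub>}"
  by (auto simp: is_submodule_def smult_zero)

end

section \<open>Components of algebra elements and of scalar multiples\<close>

sublocale graded_algebra \<subseteq> reg: graded_module S "regular S"
  by (rule graded_module_regular)

context graded_algebra
begin

abbreviation part :: "'s \<Rightarrow> 'g \<Rightarrow> 's" where "part \<equiv> reg.component"

text \<open>Lets \<open>simplified\<close> turn facts about sums in the regular module into facts
  about sums in \<open>S\<close>.\<close>

lemma finsum_regular [simp]: "finsum (regular S) = finsum S"
  by (rule finsum_same_add) auto

lemmas grade_in_carrier = reg.grade_closed[simplified]
lemmas zero_in_grade = reg.zero_grade[simplified]
lemmas add_in_grade = reg.add_grade[simplified]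
lemmas part_grade = reg.comp_grade[simplified]
lemmas part_closed = reg.comp_closed[simplified]
lemmas part_finite = reg.comp_finite[simplified]
lemmas part_add = reg.comp_add[simplified]
lemmas part_zero [simp] = reg.comp_zero[simplified]
lemmas part_homogeneous = reg.comp_homogeneous[simplified]
lemmas finsum_part = reg.finsum_comp[simplified]

lemma minus_in_grade: "x \<in> grade S \<alpha> \<Longrightarrow> \<ominus> x \<in> grade S \<alpha>"
  using grading is_abelian_group by (auto simp: is_grading_def additive_subgroup_iff)

end

locale algebra_module = graded_algebra K S + M: graded_module S M
  for K :: "'k ring" and S :: "('g::ab_group_add, 'k, 's) gmodule" (structure)
    and M :: "('g, 's, 'm) gmodule"
begin

text \<open>A convolution formula: split the scalar into its homogeneous parts and shift by the
  degree of each part.\<close>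

lemma comp_smult:
  assumes a: "a \<in> carrier S" and x: "x \<in> carrier M"
  shows "M.component (a \<odot>\<^bsub>M\<^esub> x) \<alpha> =
    (\<Oplus>\<^bsub>M\<^esub>\<delta>\<in>{\<delta>. part a \<delta> \<noteq> \<zero>}. part a \<delta> \<odot>\<^bsub>M\<^esub> M.component x (\<alpha> - \<delta>))"
proof -
  let ?B = "{\<delta>. part a \<delta> \<noteq> \<zero>}"
  have smd: "(finsum S f B) \<odot>\<^bsub>M\<^esub> x = (\<Oplus>\<^bsub>M\<^esub>i\<in>B. f i \<odot>\<^bsub>M\<^esub> x)" if "f \<in> B \<rightarrow> carrier S" for f and B :: "'g set"
    using that
  proof (induct B rule: infinite_finite_induct)
    case (insert b B)
    then show ?case
      by (simp add: M.smult_l_distr M.smult_closed x Pi_iff)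
  qed (auto simp: M.zero_smult x)
  have "a = finsum S (part a) ?B"
    using finsum_part[OF a part_finite[OF a]] by simp
  then have "a \<odot>\<^bsub>M\<^esub> x = (\<Oplus>\<^bsub>M\<^esub>\<delta>\<in>?B. part a \<delta> \<odot>\<^bsub>M\<^esub> x)"
    using smd[of "part a" ?B] part_closed[OF a] by (metis (no_types, lifting) Pi_I)
  then have "M.component (a \<odot>\<^bsub>M\<^esub> x) \<alpha> = (\<Oplus>\<^bsub>M\<^esub>\<delta>\<in>?B. M.component (part a \<delta> \<odot>\<^bsub>M\<^esub> x) \<alpha>)"
    using M.comp_finsum[of ?B "\<lambda>\<delta>. part a \<delta> \<odot>\<^bsub>M\<^esub> x"] by (simp add: M.smult_closed part_closed a x)
  then show ?thesis
    using M.comp_smult_homogeneous[OF part_closed[OF a] part_grade[OF a] x] by simp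
qed

text \<open>Elements all of whose components lie in the hull form a submodule, by the convolution
  formula, and this submodule contains \<open>G\<close>. Hence the hull is a graded
  submodule.\<close>

lemma comp_in_hull:
  assumes G: "G \<subseteq> carrier M" and h: "\<And>x \<alpha>. x \<in> G \<Longrightarrow> M.component x \<alpha> \<in> M.is_submodule hull G"
    and y: "y \<in> M.is_submodule hull G"
  shows "M.component y \<alpha> \<in> M.is_submodule hull G"
proof -
  let ?H = "M.is_submodule hull G"
  let ?T = "{y \<in> carrier M. \<forall>\<alpha>. M.component y \<alpha> \<in> ?H}"
  have H: "M.is_submodule ?H" by (rule M.is_submodule_hull[OF G])
  have "M.is_submodule ?T"
  proof (rule M.is_submoduleI)
    fix a x assume a: "a \<in> carrier S" and x: "x \<in> ?T"
    have "part a \<delta> \<odot>\<^bsub>M\<^esub> M.component x (\<alpha> - \<delta>) \<in> ?H" for \<alpha> \<delta>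
      using H x part_closed[OF a] by (auto simp: M.is_submodule_def)
    then show "a \<odot>\<^bsub>M\<^esub> x \<in> ?T"
      using a x by (auto simp: comp_smult M.smult_closed intro!: M.is_submodule_finsum[OF H])
  qed (use H in \<open>auto simp: M.comp_add M.is_submodule_def\<close>)
  moreover have "G \<subseteq> ?T" using G h by auto
  ultimately have "?H \<subseteq> ?T" by (intro hull_minimal)
  then show ?thesis using y by blast
qed

end

context graded_algebra
begin

lemma a_inv_regular [simp]: "x \<in> carrier S \<Longrightarrow> \<ominus>\<^bsub>regular S\<^esub> x = \<ominus> x"
  using reg.M.minus_equality[of "\<ominus> x" x] by (simp add: l_neg)

lemma part_minus:
  assumes "x \<in> carrier S"
  shows "part (\<ominus> x) \<alpha> = \<ominus> part x \<alpha>"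
proof (rule minus_equality[symmetric])
  show "part (\<ominus> x) \<alpha> \<oplus> part x \<alpha> = \<zero>"
    using assms by (simp add: part_add[symmetric] l_neg)
qed (simp_all add: assms part_closed)

text \<open>Passes from closure under components to the form used in \<open>graded_ideal\<close>:
  each element is the finite sum of its components.\<close>

lemma generate_homogeneous_subset:
  assumes H: "subgroup H (add_monoid S)" and h: "\<And>x \<alpha>. x \<in> H \<Longrightarrow> part x \<alpha> \<in> H"
  shows "H = generate (add_monoid S) (\<Union>\<alpha>. H \<inter> grade S \<alpha>)" (is "H = ?G")
proof
  show "?G \<subseteq> H" using H by (intro add.generate_subgroup_incl) auto
  have G: "subgroup ?G (add_monoid S)"
    using grade_in_carrier by (intro add.generate_is_subgroup) auto
  show "H \<subseteq> ?G"
  proof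
    fix x assume x: "x \<in> H"
    then have xc: "x \<in> carrier S" using subgroup.subset[OF H] by auto
    have "finsum S (part x) {\<alpha>. part x \<alpha> \<noteq> \<zero>} \<in> ?G"
      using h[OF x] part_grade[OF xc] by (intro subgroup_finsum[OF G] generate.incl) auto
    then show "x \<in> ?G" using finsum_part[OF xc part_finite[OF xc]] by simp
  qed
qed

end

subsection \<open>The maximal graded ideal\<close>

text \<open>The identification of the degree 0 piece with the field is expressed by bijectivity of
  the structure map. Both inclusions of the second assumption are used: nonzero scalars are units,
  and a homogeneous unit is a scalar.\<close>

locale scalar_units_algebra = graded_algebra K S
  for K :: "'k ring" and S :: "('g::ab_group_add, 'k, 's) gmodule" (structure) +
  assumes scalars: "bij_betw (\<lambda>a. a \<odot> \<one>) (carrier K) (grade S 0)"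
    and homogeneous_units: "{u \<in> Units S. \<exists>\<alpha>. u \<in> grade S \<alpha>} = (\<lambda>a. a \<odot> \<one>) ` (carrier K - {\<zero>\<^bsub>K\<^esub>})"
begin

abbreviation \<mm> :: "'s set" where "\<mm> \<equiv> nonzero_degree_part S"

lemma scalarE:
  assumes "x \<in> grade S 0"
  obtains a where "a \<in> carrier K" "x = a \<odot> \<one>"
  using assms scalars unfolding bij_betw_def by blast

lemma zero_scalar: "\<zero>\<^bsub>K\<^esub> \<odot> x = \<zero>" if "x \<in> carrier S"
  using that by (simp add: KS.smult_l_null)

lemma degree_zero_Units:
  assumes "x \<in> grade S 0" "x \<noteq> \<zero>"
  shows "x \<in> Units S"
proof -
  obtain a where "a \<in> carrier K" "x = a \<odot> \<one>" by (rule scalarE[OF assms(1)])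
  then have "x \<in> (\<lambda>a. a \<odot> \<one>) ` (carrier K - {\<zero>\<^bsub>K\<^esub>})"
    using assms(2) zero_scalar by auto
  then show ?thesis unfolding homogeneous_units[symmetric] by simp
qed

lemma one_not_zero: "\<one> \<noteq> \<zero>"
proof
  assume "\<one> = \<zero>"
  then have "\<one>\<^bsub>K\<^esub> \<odot> \<one> = \<zero>\<^bsub>K\<^esub> \<odot> \<one>" by (simp add: KS.smult_r_null)
  then have "\<one>\<^bsub>K\<^esub> = \<zero>\<^bsub>K\<^esub>"
    using scalars by (intro inj_onD[of "\<lambda>a. a \<odot> \<one>" "carrier K"]) (auto simp: bij_betw_def)
  then show False using K.one_not_zero by simp
qed

text \<open>If \<open>x y\<close> is a nonzero scalar \<open>c\<close>, then comparing \<open>(x y) x\<close> with \<open>x (y x)\<close> shows \<open>y x = c\<close>, so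
  \<open>x\<close> is a homogeneous unit of nonzero degree.\<close>

lemma mult_opposite_degrees:
  assumes x: "x \<in> grade S \<alpha>" and y: "y \<in> grade S (- \<alpha>)" and \<alpha>: "\<alpha> \<noteq> 0"
  shows "x \<otimes> y = \<zero>"
proof (rule ccontr)
  assume nz: "x \<otimes> y \<noteq> \<zero>"
  have xc: "x \<in> carrier S" and yc: "y \<in> carrier S" using x y grade_in_carrier by auto
  have "x \<otimes> y \<in> grade S 0" "y \<otimes> x \<in> grade S 0"
    using grade_mult[OF x y] grade_mult[OF y x] by auto
  then obtain c d where c: "c \<in> carrier K" "x \<otimes> y = c \<odot> \<one>"
    and d: "d \<in> carrier K" "y \<otimes> x = d \<odot> \<one>" by (metis scalarE)
  have c0: "c \<noteq> \<zero>\<^bsub>K\<^esub>" using c nz by (auto simp: zero_scalar)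
  have x0: "x \<noteq> \<zero>" using nz yc by auto
  have "c \<odot> x = x \<otimes> y \<otimes> x" using c xc by (simp add: smult_mult_left)
  also have "\<dots> = x \<otimes> (y \<otimes> x)" using xc yc by (simp add: m_assoc)
  also have "\<dots> = d \<odot> x" using d xc by (simp add: smult_mult_right)
  finally have eq: "c \<odot> x = d \<odot> x" .
  have ci: "inv\<^bsub>K\<^esub> c \<in> carrier K" "inv\<^bsub>K\<^esub> c \<otimes>\<^bsub>K\<^esub> c = \<one>\<^bsub>K\<^esub>"
    using c c0 K.field_Units by auto
  \<comment> \<open>Otherwise \<open>c \<odot> x\<close> would vanish, and cancelling the invertible
    \<open>c\<close> would give \<open>x = \<zero>\<close>.\<close>
  have d0: "d \<noteq> \<zero>\<^bsub>K\<^esub>"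
  proof
    assume "d = \<zero>\<^bsub>K\<^esub>"
    then have "c \<odot> x = \<zero>" using eq xc by (simp add: zero_scalar)
    then have "(inv\<^bsub>K\<^esub> c \<otimes>\<^bsub>K\<^esub> c) \<odot> x = \<zero>"
      using ci c xc by (subst KS.smult_assoc1) (auto simp: KS.smult_r_null)
    then show False using ci xc x0 by simp
  qed
  have di: "inv\<^bsub>K\<^esub> d \<in> carrier K" "inv\<^bsub>K\<^esub> d \<otimes>\<^bsub>K\<^esub> d = \<one>\<^bsub>K\<^esub>"
    using d d0 K.field_Units by auto
  have r: "x \<otimes> (inv\<^bsub>K\<^esub> c \<odot> y) = \<one>"
    using c ci xc yc by (simp add: smult_mult_right KS.smult_assoc1[symmetric])
  have l: "(inv\<^bsub>K\<^esub> d \<odot> y) \<otimes> x = \<one>"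
    using d di xc yc by (simp add: smult_mult_left KS.smult_assoc1[symmetric])
  have "inv\<^bsub>K\<^esub> d \<odot> y = inv\<^bsub>K\<^esub> c \<odot> y"
    using inv_unique[OF l r] xc yc ci(1) di(1) by simp
  then have "x \<in> Units S"
    using r l xc yc ci(1) by (auto simp: Units_def intro!: bexI[of _ "inv\<^bsub>K\<^esub> c \<odot> y"])
  then have "x \<in> (\<lambda>a. a \<odot> \<one>) ` (carrier K - {\<zero>\<^bsub>K\<^esub>})"
    unfolding homogeneous_units[symmetric] using x by blast
  then have "x \<in> grade S 0" using scalars by (auto simp: bij_betw_def)
  \<comment> \<open>Now \<open>x\<close> is homogeneous of the two distinct degrees 0 and \<alpha>,
    so its component in degree \<alpha> is both zero and \<open>x\<close>.\<close>
  then have "part x \<alpha> = \<zero>" using \<alpha> part_homogeneous by simp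
  then show False using x0 part_homogeneous[OF x] by simp
qed

text \<open>In the convolution for degree 0 every term pairs opposite degrees, so only the term with
  both degrees 0 survives.\<close>

lemma part_mult_zero:
  assumes x: "x \<in> carrier S" and y: "y \<in> carrier S"
  shows "part (x \<otimes> y) 0 = part x 0 \<otimes> part y 0"
proof -
  interpret R: algebra_module K S "regular S" ..
  let ?B = "{\<delta>. part x \<delta> \<noteq> \<zero>}"
  let ?f = "\<lambda>\<delta>. part x \<delta> \<otimes> part y (- \<delta>)"
  have "part (x \<otimes> y) 0 = finsum S ?f ?B"
    using R.comp_smult[of x y 0] x y by simp
  \<comment> \<open>The support of \<open>x\<close> may miss 0, so 0 is added first and the sum is
    then cut down to it.\<close>
  also have "\<dots> = finsum S ?f (insert 0 ?B)"
    using x y by (intro reg.finsum_extend[simplified]) (auto simp: part_finite part_closed)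
  also have "\<dots> = finsum S ?f {0}"
    using x y mult_opposite_degrees[OF part_grade[OF x] part_grade[OF y]]
    by (intro reg.finsum_extend[simplified, symmetric]) (auto simp: part_finite part_closed)
  also have "\<dots> = part x 0 \<otimes> part y 0"
    using x y by (subst finsum_insert) (auto simp: part_closed)
  finally show ?thesis .
qed

text \<open>Replaces generation by a single equation: \<open>\<mm>\<close> is the kernel of the
  degree 0 part, which is additive and multiplicative, so it is a two-sided ideal.\<close>

lemma nonzero_degree_part_eq: "\<mm> = {x \<in> carrier S. part x 0 = \<zero>}" (is "_ = ?T")
proof
  have T: "subgroup ?T (add_monoid S)"
    by unfold_locales (auto simp: part_add part_minus a_inv_def[symmetric])
  show "\<mm> \<subseteq> ?T"
    unfolding nonzero_degree_part_def
    using T by (intro add.generate_subgroup_incl) (auto simp: grade_in_carrier part_homogeneous)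
  have G: "subgroup \<mm> (add_monoid S)"
    unfolding nonzero_degree_part_def
    using grade_in_carrier by (intro add.generate_is_subgroup) auto
  show "?T \<subseteq> \<mm>"
  proof
    fix x assume x: "x \<in> ?T"
    then have xc: "x \<in> carrier S" by simp
    have "finsum S (part x) {\<alpha>. part x \<alpha> \<noteq> \<zero>} \<in> \<mm>"
    proof (rule subgroup_finsum[OF G])
      fix \<alpha> assume "\<alpha> \<in> {\<alpha>. part x \<alpha> \<noteq> \<zero>}"
      then have "\<alpha> \<noteq> 0" using x by auto
      then show "part x \<alpha> \<in> \<mm>"
        unfolding nonzero_degree_part_def using part_grade[OF xc] by (intro generate.incl) auto
    qed
    then show "x \<in> \<mm>" using finsum_part[OF xc part_finite[OF xc]] by simp
  qed
qed

lemma ideal_nonzero_degree_part: "ideal \<mm> S"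
  unfolding nonzero_degree_part_eq
  by (rule idealI[OF ring_axioms])
    (unfold_locales, auto simp: part_add part_minus part_mult_zero part_closed a_inv_def[symmetric])

lemma graded_ideal_nonzero_degree_part: "graded_ideal S \<mm>"
proof -
  have "subgroup \<mm> (add_monoid S)"
    using ideal_nonzero_degree_part by (simp add: additive_subgroup.a_subgroup ideal_def)
  then show ?thesis
    unfolding graded_ideal_def
    using ideal_nonzero_degree_part
    by (intro conjI generate_homogeneous_subset)
      (auto simp: nonzero_degree_part_eq part_closed part_homogeneous[OF part_grade])
qed

lemma one_notin_nonzero_degree_part: "\<one> \<notin> \<mm>"
  using one_not_zero grade_one by (simp add: nonzero_degree_part_eq part_homogeneous)

text \<open>A nonzero element of degree 0 is a unit, so a proper ideal contains none; the
  homogeneous generators of \<open>J\<close> therefore lie in \<open>\<mm>\<close>. Thus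
  \<open>\<mm>\<close> is even the largest proper graded ideal.\<close>

lemma proper_graded_ideal_subset:
  assumes J: "graded_ideal S J" and ne: "J \<noteq> carrier S"
  shows "J \<subseteq> \<mm>"
proof -
  interpret J: ideal J S using J by (simp add: graded_ideal_def)
  have m: "subgroup \<mm> (add_monoid S)"
    using ideal_nonzero_degree_part by (simp add: additive_subgroup.a_subgroup ideal_def)
  have "x \<in> \<mm>" if x: "x \<in> J" "x \<in> grade S \<alpha>" for x \<alpha>
  proof (cases "\<alpha> = 0")
    case False
    then show ?thesis using x by (simp add: nonzero_degree_part_eq part_homogeneous grade_in_carrier)
  next
    case True
    have "x = \<zero>"
    proof (rule ccontr)
      assume "x \<noteq> \<zero>"
      then have "x \<in> Units S" using degree_zero_Units x True by blast
      then have "inv x \<otimes> x = \<one>" "inv x \<in> carrier S" by auto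
      then have "\<one> \<in> J" using J.I_l_closed[OF x(1)] by metis
      then show False using ne J.one_imp_carrier by blast
    qed
    then show ?thesis by (simp add: nonzero_degree_part_eq)
  qed
  then have "generate (add_monoid S) (\<Union>\<alpha>. J \<inter> grade S \<alpha>) \<subseteq> \<mm>"
    using m by (intro add.generate_subgroup_incl) auto
  then show ?thesis using J by (simp add: graded_ideal_def)
qed

lemma maximal_graded_ideal_iff: "maximal_graded_ideal S J \<longleftrightarrow> J = \<mm>"
proof -
  have "\<mm> \<noteq> carrier S" using one_notin_nonzero_degree_part by auto
  then show ?thesis
    unfolding maximal_graded_ideal_def
    using proper_graded_ideal_subset graded_ideal_nonzero_degree_part by blast
qed

end

subsection \<open>Nakayama's lemma\<close>

lemma gr_hom_component:
  assumes M: "graded_module S M" and N: "graded_module S N" and f: "f \<in> gr_hom S M N"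
    and x: "x \<in> carrier M"
  shows "graded_module.component N (f x) \<alpha> = f (graded_module.component M x \<alpha>)"
proof -
  interpret M: graded_module S M by fact
  interpret N: graded_module S N by fact
  let ?B = "{\<alpha>. M.component x \<alpha> \<noteq> \<zero>\<^bsub>M\<^esub>}"
  have "N.component (f x) = (\<lambda>\<alpha>. f (M.component x \<alpha>))"
  proof (rule N.comp_eqI[of _ ?B])
    have "f (finsum M (M.component x) ?B) = (\<Oplus>\<^bsub>N\<^esub>\<alpha>\<in>?B. f (M.component x \<alpha>))"
      using M.comp_closed[OF x] by (intro gr_hom_finsum[OF M N f]) auto
    then show "f x = (\<Oplus>\<^bsub>N\<^esub>\<alpha>\<in>?B. f (M.component x \<alpha>))"
      using M.finsum_comp[OF x M.comp_finite[OF x]] by auto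
  qed (use x M.comp_grade M.comp_finite gr_homD[OF f] gr_hom_zero[OF M N f] in auto)
  then show ?thesis by simp
qed

lemma gr_hom_image_submodule:
  assumes M: "graded_module S M" and N: "graded_module S N" and f: "f \<in> gr_hom S M N"
  shows "graded_module.is_submodule S N (f ` carrier M)"
proof -
  interpret M: graded_module S M by fact
  interpret N: graded_module S N by fact
  note h = gr_homD[OF f]
  show ?thesis
  proof (rule N.is_submoduleI)
    show "\<zero>\<^bsub>N\<^esub> \<in> f ` carrier M" using gr_hom_zero[OF M N f] by (metis M.M.zero_closed imageI)
    show "x \<oplus>\<^bsub>N\<^esub> y \<in> f ` carrier M" if "x \<in> f ` carrier M" "y \<in> f ` carrier M" for x y
      using that h(2) by (metis (no_types, lifting) M.M.a_closed image_iff)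
    show "a \<odot>\<^bsub>N\<^esub> x \<in> f ` carrier M" if "a \<in> carrier S" "x \<in> f ` carrier M" for a x
      using that h(3) by (metis (no_types, lifting) M.smult_closed image_iff)
  qed (use h in auto)
qed

context algebra_module
begin

text \<open>In the convolution formula only the part of \<open>a\<close> that carries degree
  \<epsilon> to degree \<alpha> contributes.\<close>

lemma comp_smult_of_homogeneous:
  assumes a: "a \<in> carrier S" and x: "x \<in> grade M \<epsilon>"
  shows "M.component (a \<odot>\<^bsub>M\<^esub> x) \<alpha> = part a (\<alpha> - \<epsilon>) \<odot>\<^bsub>M\<^esub> x"
proof -
  let ?B = "{\<delta>. part a \<delta> \<noteq> \<zero>}"
  let ?f = "\<lambda>\<delta>. part a \<delta> \<odot>\<^bsub>M\<^esub> M.component x (\<alpha> - \<delta>)"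
  have xc: "x \<in> carrier M" using x by (rule M.grade_closed)
  have "M.component (a \<odot>\<^bsub>M\<^esub> x) \<alpha> = finsum M ?f ?B"
    using comp_smult[OF a xc] .
  also have "\<dots> = finsum M ?f (insert (\<alpha> - \<epsilon>) ?B)"
    using a xc by (intro M.finsum_extend)
      (auto simp: part_finite part_closed M.comp_closed M.smult_closed M.zero_smult)
  also have "\<dots> = finsum M ?f {\<alpha> - \<epsilon>}"
    using a xc by (intro M.finsum_extend[symmetric])
      (auto simp: part_finite part_closed M.comp_closed M.smult_closed M.smult_zero M.comp_homogeneous[OF x])
  also have "\<dots> = part a (\<alpha> - \<epsilon>) \<odot>\<^bsub>M\<^esub> x"
    using a xc by (subst M.M.finsum_insert)
      (auto simp: part_closed M.smult_closed M.comp_homogeneous[OF x])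
  finally show ?thesis .
qed

text \<open>Each generator is replaced by its finitely many nonzero components, whose sum gives the
  generator back.\<close>

lemma fin_gen_homogeneous:
  assumes "fin_gen S M"
  obtains G where "finite G" "G \<subseteq> (\<Union>\<alpha>. grade M \<alpha>)" "M.is_submodule hull G = carrier M"
proof -
  obtain A where A: "finite A" "A \<subseteq> carrier M"
    and gen: "\<And>x. x \<in> carrier M \<Longrightarrow> \<exists>c \<in> A \<rightarrow> carrier S. x = (\<Oplus>\<^bsub>M\<^esub>a\<in>A. c a \<odot>\<^bsub>M\<^esub> a)"
    using assms unfolding fin_gen_def by blast
  let ?G = "\<Union>a\<in>A. M.component a ` {\<alpha>. M.component a \<alpha> \<noteq> \<zero>\<^bsub>M\<^esub>}"
  have fin: "finite ?G" using A M.comp_finite by blast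
  have hom: "?G \<subseteq> (\<Union>\<alpha>. grade M \<alpha>)" using A M.comp_grade by blast
  then have "?G \<subseteq> carrier M" using M.grade_closed by blast
  then have H: "M.is_submodule (M.is_submodule hull ?G)" by (rule M.is_submodule_hull)
  have a: "a \<in> M.is_submodule hull ?G" if "a \<in> A" for a
  proof -
    have "finsum M (M.component a) {\<alpha>. M.component a \<alpha> \<noteq> \<zero>\<^bsub>M\<^esub>} \<in> M.is_submodule hull ?G"
      using that by (intro M.is_submodule_finsum[OF H] hull_inc) auto
    moreover have ac: "a \<in> carrier M" using that A by blast
    ultimately show ?thesis using M.finsum_comp[OF ac M.comp_finite[OF ac]] by simp
  qed
  have "x \<in> M.is_submodule hull ?G" if "x \<in> carrier M" for x
  proof -
    obtain c where c: "c \<in> A \<rightarrow> carrier S" and x: "x = (\<Oplus>\<^bsub>M\<^esub>a\<in>A. c a \<odot>\<^bsub>M\<^esub> a)" using gen[OF \<open>x \<in> carrier M\<close>] by blast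
    have "c a \<odot>\<^bsub>M\<^esub> a \<in> M.is_submodule hull ?G" if "a \<in> A" for a
      by (rule M.is_submoduleD(4)[OF H funcset_mem[OF c that] a[OF that]])
    then show ?thesis unfolding x by (rule M.is_submodule_finsum[OF H])
  qed
  then have "M.is_submodule hull ?G = carrier M"
    using M.is_submoduleD(1)[OF H] by blast
  then show ?thesis using that fin hom by blast
qed

end

locale scalar_units_module = scalar_units_algebra K S + algebra_module K S M
  for K :: "'k ring" and S :: "('g::ab_group_add, 'k, 's) gmodule" (structure)
    and M :: "('g, 's, 'm) gmodule"
begin

lemma nonzero_degree_partD:
  assumes "a \<in> \<mm>"
  shows "a \<in> carrier S" "part a 0 = \<zero>"
  using assms by (auto simp: nonzero_degree_part_eq)

lemma nonzero_degree_part_mult: "a \<in> \<mm> \<Longrightarrow> s \<in> carrier S \<Longrightarrow> a \<otimes> s \<in> \<mm>"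
  using ideal.I_r_closed[OF ideal_nonzero_degree_part] .

text \<open>Modulo a graded submodule containing the other generators, the component of an element of
  \<open>\<mm>M\<close> in the degree of a generator \<open>g\<close> is \<open>a g\<close> with \<open>a\<close> the degree 0 part of an element
  of \<open>\<mm>\<close>, so it vanishes.\<close>

lemma nakayama:
  assumes "finite G" "G \<subseteq> (\<Union>\<alpha>. grade M \<alpha>)"
    and "M.is_submodule L" "\<And>x \<alpha>. x \<in> L \<Longrightarrow> M.component x \<alpha> \<in> L"
    and "M.is_submodule hull (L \<union> G) = carrier M"
    and "\<And>x. x \<in> carrier M \<Longrightarrow> \<exists>l\<in>L. \<exists>z\<in>ideal_smult \<mm> M. x = l \<oplus>\<^bsub>M\<^esub> z"
  shows "L = carrier M"
  using assms
proof (induct G arbitrary: L)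
  case empty
  show ?case using empty.prems(4) hull_same[of M.is_submodule L, OF empty.prems(2)] by simp
next
  case (insert g G)
  obtain d where g: "g \<in> grade M d" using insert.prems(1) by auto
  have gc: "g \<in> carrier M" using g by (rule M.grade_closed)
  have Lc: "L \<subseteq> carrier M" using insert.prems(2) by (simp add: M.is_submodule_def)
  note L = M.is_submoduleD[OF insert.prems(2)]
  let ?H = "M.is_submodule hull (insert g L)"
  \<comment> \<open>The induction hypothesis is applied to \<open>L\<close> enlarged by
    \<open>g\<close>, with the remaining generators \<open>G\<close>. So \<open>g\<close> alone
    generates \<open>M\<close> modulo \<open>L\<close>, and it remains to show that \<open>g\<close>
    lies in \<open>L\<close>.\<close>
  have H: "?H = carrier M"
  proof (rule insert.hyps(3))
    show "G \<subseteq> (\<Union>\<alpha>. grade M \<alpha>)" using insert.prems(1) by blast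
    show "M.is_submodule ?H" using gc Lc by (intro M.is_submodule_hull) auto
    have "M.component x \<alpha> \<in> ?H" if "x \<in> insert g L" for x \<alpha>
    proof (cases "x = g \<and> \<alpha> \<noteq> d")
      case True
      then have "M.component x \<alpha> = \<zero>\<^bsub>M\<^esub>" using M.comp_homogeneous[OF g] by simp
      then show ?thesis using L(2) by (simp add: hull_inc)
    next
      case False
      then have "M.component x \<alpha> \<in> insert g L"
        using that insert.prems(3)[of x \<alpha>] M.comp_homogeneous[OF g] by (cases "x = g") auto
      then show ?thesis by (rule hull_inc)
    qed
    then show "M.component x \<alpha> \<in> ?H" if "x \<in> ?H" for x \<alpha>
      using gc Lc by (intro comp_in_hull[OF _ _ that]) auto
    show "M.is_submodule hull (?H \<union> G) = carrier M"
      using insert.prems(4) by (simp add: hull_Un_left[symmetric])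
    show "\<exists>l\<in>?H. \<exists>z\<in>ideal_smult \<mm> M. x = l \<oplus>\<^bsub>M\<^esub> z" if "x \<in> carrier M" for x
      using insert.prems(5)[OF that] hull_inc[of _ "insert g L" M.is_submodule] by (metis insertCI)
  qed
  \<comment> \<open>Quantifying over all of \<open>\<mm>\<close> makes this set closed under
    scalars, because \<open>\<mm>\<close> absorbs multiplication on the right. It contains
    \<open>g\<close> and \<open>L\<close>, hence is all of \<open>M\<close>.\<close>
  let ?T = "{y \<in> carrier M. \<forall>a\<in>\<mm>. M.component (a \<odot>\<^bsub>M\<^esub> y) d \<in> L}"
  have "M.is_submodule ?T"
  proof (rule M.is_submoduleI)
    show "x \<oplus>\<^bsub>M\<^esub> y \<in> ?T" if "x \<in> ?T" "y \<in> ?T" for x y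
      using that by (auto simp: nonzero_degree_partD M.smult_r_distr M.comp_add M.smult_closed L(3))
    show "s \<odot>\<^bsub>M\<^esub> x \<in> ?T" if "s \<in> carrier S" "x \<in> ?T" for s x
      using that by (auto simp: M.smult_closed nonzero_degree_partD M.smult_assoc[symmetric] nonzero_degree_part_mult)
  qed (auto simp: nonzero_degree_partD M.smult_zero L(2))
  moreover have "insert g L \<subseteq> ?T"
  proof -
    have "M.component (a \<odot>\<^bsub>M\<^esub> g) d \<in> L" if "a \<in> \<mm>" for a
      using gc L(2) nonzero_degree_partD[OF that]
      by (simp add: comp_smult_of_homogeneous[OF _ g] M.zero_smult)
    moreover have "M.component (a \<odot>\<^bsub>M\<^esub> x) d \<in> L" if "a \<in> \<mm>" "x \<in> L" for a x
      using L(4)[OF nonzero_degree_partD(1) that(2)] that(1) insert.prems(3) by blast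
    ultimately show ?thesis using gc Lc by auto
  qed
  ultimately have "?H \<subseteq> ?T" by (intro hull_minimal)
  then have T: "M.component (a \<odot>\<^bsub>M\<^esub> y) d \<in> L" if "a \<in> \<mm>" "y \<in> carrier M" for a y
    using H that by auto
  have "M.component z d \<in> L" if "z \<in> ideal_smult \<mm> M" for z
  proof -
    let ?U = "{y \<in> carrier M. M.component y d \<in> L}"
    have "M.component (\<ominus>\<^bsub>M\<^esub> y) d \<in> L" if "y \<in> ?U" for y
    proof -
      have "M.component (\<ominus>\<^bsub>M\<^esub> y) d = (\<ominus> \<one>) \<odot>\<^bsub>M\<^esub> M.component y d"
        using that M.comp_smult_homogeneous[OF _ minus_in_grade[OF grade_one], of y d]
        by (simp add: M.smult_minus_one)
      then show ?thesis using L(4)[of "\<ominus> \<one>"] that by simp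
    qed
    then have "subgroup ?U (add_monoid M)"
      by unfold_locales (auto simp: M.comp_add a_inv_def[symmetric] L(2,3))
    then have "ideal_smult \<mm> M \<subseteq> ?U"
      unfolding ideal_smult_def using T
      by (intro M.M.add.generate_subgroup_incl) (auto simp: M.smult_closed nonzero_degree_partD)
    then show ?thesis using that by blast
  qed
  \<comment> \<open>Comparing components in degree \<open>d\<close>, where \<open>g\<close> is its
    own component, puts \<open>g\<close> into \<open>L\<close>.\<close>
  moreover obtain l z where lz: "l \<in> L" "z \<in> ideal_smult \<mm> M" "g = l \<oplus>\<^bsub>M\<^esub> z"
    using insert.prems(5)[OF gc] by blast
  moreover have "z \<in> carrier M"
  proof -
    have "ideal_smult \<mm> M \<subseteq> carrier M"
      unfolding ideal_smult_def
      by (rule M.M.add.generate_incl[simplified]) (auto simp: M.smult_closed nonzero_degree_partD)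
    then show ?thesis using lz by blast
  qed
  ultimately have "M.component g d \<in> L"
    using Lc insert.prems(3) L(3) by (auto simp: M.comp_add)
  then have "g \<in> L" using M.comp_homogeneous[OF g] by simp
  then show ?case using H insert.prems(2) by (simp add: insert_absorb hull_same)
qed

text \<open>The case of the zero submodule in \<open>nakayama\<close>: every \<open>x\<close> is
  zero plus an element of \<open>\<mm>M\<close>.\<close>

lemma graded_nakayama:
  assumes "fin_gen S M" "ideal_smult \<mm> M = carrier M"
  shows "carrier M = {\<zero>\<^bsub>M\<^esub>}"
proof -
  obtain G where G: "finite G" "G \<subseteq> (\<Union>\<alpha>. grade M \<alpha>)" "M.is_submodule hull G = carrier M"
    using fin_gen_homogeneous[OF assms(1)] .
  have "{\<zero>\<^bsub>M\<^esub>} \<union> G \<subseteq> carrier M" using G(2) M.grade_closed by auto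
  then have "M.is_submodule hull ({\<zero>\<^bsub>M\<^esub>} \<union> G) \<subseteq> carrier M"
    using M.is_submodule_carrier by (rule hull_minimal)
  moreover have "carrier M \<subseteq> M.is_submodule hull ({\<zero>\<^bsub>M\<^esub>} \<union> G)"
    unfolding G(3)[symmetric] by (intro hull_mono) auto
  ultimately have "M.is_submodule hull ({\<zero>\<^bsub>M\<^esub>} \<union> G) = carrier M" by (rule subset_antisym)
  then have "{\<zero>\<^bsub>M\<^esub>} = carrier M"
    using assms(2) by (intro nakayama[OF G(1,2) M.zero_submodule]) auto
  then show ?thesis ..
qed

end

subsection \<open>Graded free modules\<close>

context graded_algebra
begin

lemma graded_module_gr_free: "graded_module S (gr_free S \<alpha>s)"
  unfolding gr_free_def
  by (rule graded_module_direct_sum[OF graded_algebra_axioms reg.graded_module_twist])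

lemma gr_free_simps:
  "carrier (gr_free S \<alpha>s) = {..<length \<alpha>s} \<rightarrow>\<^sub>E carrier S"
  "\<zero>\<^bsub>gr_free S \<alpha>s\<^esub> = (\<lambda>i\<in>{..<length \<alpha>s}. \<zero>)"
  "x \<oplus>\<^bsub>gr_free S \<alpha>s\<^esub> y = (\<lambda>i\<in>{..<length \<alpha>s}. x i \<oplus> y i)"
  "a \<odot>\<^bsub>gr_free S \<alpha>s\<^esub> x = (\<lambda>i\<in>{..<length \<alpha>s}. a \<otimes> x i)"
  "grade (gr_free S \<alpha>s) \<beta> = (\<Pi>\<^sub>E i\<in>{..<length \<alpha>s}. grade S (\<alpha>s ! i + \<beta>))"
  by (simp_all add: gr_free_def gr_direct_sum_simps)

lemma finsum_gr_free:
  assumes "\<And>a. a \<in> A \<Longrightarrow> f a \<in> carrier (gr_free S \<alpha>s)" "i < length \<alpha>s"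
  shows "finsum (gr_free S \<alpha>s) f A i = (\<Oplus>a\<in>A. f a i)"
proof -
  interpret F: graded_module S "gr_free S \<alpha>s" by (rule graded_module_gr_free)
  show ?thesis using assms(1)
  proof (induct A rule: infinite_finite_induct)
    case (insert a A)
    then have f: "f b i \<in> carrier S" if "b \<in> insert a A" for b
      using that assms(2) by (auto simp: gr_free_simps)
    have "finsum (gr_free S \<alpha>s) f (insert a A) = f a \<oplus>\<^bsub>gr_free S \<alpha>s\<^esub> finsum (gr_free S \<alpha>s) f A"
      using insert by (intro F.M.finsum_insert) auto
    moreover have "(\<Oplus>b\<in>insert a A. f b i) = f a i \<oplus> (\<Oplus>b\<in>A. f b i)"
      using insert f by (intro finsum_insert) auto
    ultimately show ?case
      using insert assms(2) by (simp add: gr_free_simps)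
  qed (use assms(2) in \<open>simp_all add: gr_free_simps\<close>)
qed

section \<open>Basis vectors and homomorphisms out of free modules\<close>

definition basis_vector :: "nat \<Rightarrow> nat \<Rightarrow> nat \<Rightarrow> 's" where
  "basis_vector n j = (\<lambda>i\<in>{..<n}. if i = j then \<one> else \<zero>)"

text \<open>The unit has degree 0 in \<open>S\<close>, hence degree -\<alpha> in the twist by
  \<alpha>.\<close>

lemma basis_vector_grade:
  "j < length \<alpha>s \<Longrightarrow> basis_vector (length \<alpha>s) j \<in> grade (gr_free S \<alpha>s) (- \<alpha>s ! j)"
  by (auto simp: gr_free_simps basis_vector_def grade_one zero_in_grade)

lemma basis_vector_closed: "basis_vector (length \<alpha>s) j \<in> carrier (gr_free S \<alpha>s)"
  by (auto simp: gr_free_simps basis_vector_def)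

lemma gr_free_expansion:
  assumes x: "x \<in> carrier (gr_free S \<alpha>s)"
  shows "x = (\<Oplus>\<^bsub>gr_free S \<alpha>s\<^esub>j\<in>{..<length \<alpha>s}. x j \<odot>\<^bsub>gr_free S \<alpha>s\<^esub> basis_vector (length \<alpha>s) j)"
    (is "x = finsum ?F ?f ?I")
proof -
  interpret F: graded_module S ?F by (rule graded_module_gr_free)
  have xc: "x i \<in> carrier S" if "i < length \<alpha>s" for i using x that by (auto simp: gr_free_simps)
  have f: "?f j \<in> carrier ?F" if "j \<in> ?I" for j
    using that xc by (intro F.smult_closed basis_vector_closed) auto
  show ?thesis
  proof (rule extensionalityI[of _ ?I])
    have ext: "y \<in> extensional ?I" if "y \<in> carrier ?F" for y
      using that by (simp add: gr_free_simps(1) PiE_def)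
    show "x \<in> extensional ?I" by (rule ext[OF x])
    show "finsum ?F ?f ?I \<in> extensional ?I"
      by (intro ext F.M.finsum_closed Pi_I f)
    fix i assume i: "i \<in> ?I"
    have "finsum ?F ?f ?I i = (\<Oplus>j\<in>?I. ?f j i)" using f i by (intro finsum_gr_free) auto
    also have "\<dots> = (\<Oplus>j\<in>?I. if i = j then x j else \<zero>)"
    proof (rule finsum_cong')
      fix j assume "j \<in> ?I"
      then show "?f j i = (if i = j then x j else \<zero>)"
        using i xc by (simp add: gr_free_simps(4) basis_vector_def)
    qed (use xc in auto)
    also have "\<dots> = x i"
      using i xc by (intro add.finprod_singleton) auto
    finally show "x i = finsum ?F ?f ?I i" ..
  qed
qed

lemma free_map_gr_free_hom:
  assumes "graded_module S M" "\<And>i. i < length \<alpha>s \<Longrightarrow> m i \<in> grade M (- \<alpha>s ! i)"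
  shows "free_map {..<length \<alpha>s} m S M \<in> gr_hom S (gr_free S \<alpha>s) M"
  using free_map_hom[OF graded_algebra_axioms assms(1), of "{..<length \<alpha>s}" m "\<lambda>i. - \<alpha>s ! i"] assms(2)
  by (simp add: gr_free_def)

lemma free_map_eq_finsum:
  assumes M: "graded_module S M" and "finite I" "m \<in> I \<rightarrow> carrier M" "c \<in> I \<rightarrow> carrier S"
  shows "free_map I m S M c = (\<Oplus>\<^bsub>M\<^esub>i\<in>I. c i \<odot>\<^bsub>M\<^esub> m i)"
proof -
  interpret M: graded_module S M by fact
  show ?thesis
    unfolding free_map_def using assms(2-)
    by (intro M.finsum_extend) (auto simp: Pi_iff M.zero_smult M.smult_closed)
qed

lemma free_map_basis_vector:
  assumes M: "graded_module S M" and m: "m \<in> {..<n} \<rightarrow> carrier M" and j: "j < n"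
  shows "free_map {..<n} m S M (basis_vector n j) = m j"
proof -
  interpret M: graded_module S M by fact
  have "free_map {..<n} m S M (basis_vector n j) = (\<Oplus>\<^bsub>M\<^esub>i\<in>{..<n}. basis_vector n j i \<odot>\<^bsub>M\<^esub> m i)"
    using m by (intro free_map_eq_finsum[OF M]) (auto simp: basis_vector_def)
  also have "\<dots> = (\<Oplus>\<^bsub>M\<^esub>i\<in>{..<n}. if j = i then m i else \<zero>\<^bsub>M\<^esub>)"
    using m by (intro M.M.finsum_cong') (auto simp: basis_vector_def M.smult_one M.zero_smult Pi_iff)
  also have "\<dots> = m j"
    using m j by (intro M.M.add.finprod_singleton) auto
  finally show ?thesis .
qed

lemma gr_hom_gr_free_expansion:
  assumes M: "graded_module S M" and f: "f \<in> gr_hom S (gr_free S \<alpha>s) M" and x: "x \<in> carrier (gr_free S \<alpha>s)"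
  shows "f x = (\<Oplus>\<^bsub>M\<^esub>j\<in>{..<length \<alpha>s}. x j \<odot>\<^bsub>M\<^esub> f (basis_vector (length \<alpha>s) j))"
proof -
  interpret M: graded_module S M by fact
  interpret F: graded_module S "gr_free S \<alpha>s" by (rule graded_module_gr_free)
  have xc: "x j \<in> carrier S" if "j \<in> {..<length \<alpha>s}" for j using x that by (auto simp: gr_free_simps)
  have "f x = f (\<Oplus>\<^bsub>gr_free S \<alpha>s\<^esub>j\<in>{..<length \<alpha>s}. x j \<odot>\<^bsub>gr_free S \<alpha>s\<^esub> basis_vector (length \<alpha>s) j)"
    by (rule arg_cong[OF gr_free_expansion[OF x]])
  also have "\<dots> = (\<Oplus>\<^bsub>M\<^esub>j\<in>{..<length \<alpha>s}. f (x j \<odot>\<^bsub>gr_free S \<alpha>s\<^esub> basis_vector (length \<alpha>s) j))"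
    using xc by (intro gr_hom_finsum[OF graded_module_gr_free M f] F.smult_closed basis_vector_closed)
  also have "\<dots> = (\<Oplus>\<^bsub>M\<^esub>j\<in>{..<length \<alpha>s}. x j \<odot>\<^bsub>M\<^esub> f (basis_vector (length \<alpha>s) j))"
    using xc gr_homD(1,3)[OF f] basis_vector_closed
    by (intro M.M.finsum_cong') (auto intro!: M.smult_closed)
  finally show ?thesis .
qed

lemma gr_free_span:
  assumes "graded_module.is_submodule S (gr_free S \<alpha>s) L"
    and "\<And>j. j < length \<alpha>s \<Longrightarrow> basis_vector (length \<alpha>s) j \<in> L"
  shows "carrier (gr_free S \<alpha>s) \<subseteq> L"
proof
  interpret F: graded_module S "gr_free S \<alpha>s" by (rule graded_module_gr_free)
  fix x assume x: "x \<in> carrier (gr_free S \<alpha>s)"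
  have "(\<Oplus>\<^bsub>gr_free S \<alpha>s\<^esub>j\<in>{..<length \<alpha>s}. x j \<odot>\<^bsub>gr_free S \<alpha>s\<^esub> basis_vector (length \<alpha>s) j) \<in> L"
    using x assms(2)
    by (intro F.is_submodule_finsum[OF assms(1)] F.is_submoduleD(4)[OF assms(1)]) (auto simp: gr_free_simps)
  then show "x \<in> L" unfolding gr_free_expansion[OF x, symmetric] .
qed

text \<open>Equal multisets give a bijection of the indices matching the twists; permuting
  coordinates along it is the isomorphism.\<close>

lemma gr_free_isomorphic_mset:
  assumes "mset \<alpha>s = mset \<beta>s"
  shows "gr_isomorphic S (gr_free S \<alpha>s) (gr_free S \<beta>s)"
proof -
  obtain p where p: "bij_betw p {..<length \<alpha>s} {..<length \<beta>s}" "\<And>i. i < length \<alpha>s \<Longrightarrow> \<alpha>s ! i = \<beta>s ! p i"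
    using permutation_Ex_bij[OF assms] by auto
  \<comment> \<open>Stated for an arbitrary index map \<open>q\<close> so that it covers both
    \<open>p\<close> and its inverse.\<close>
  have hom: "(\<lambda>x. \<lambda>i\<in>{..<length \<delta>s}. x (q i)) \<in> gr_hom S (gr_free S \<gamma>s) (gr_free S \<delta>s)"
    if q: "\<And>i. i < length \<delta>s \<Longrightarrow> q i < length \<gamma>s" and \<gamma>\<delta>: "\<And>i. i < length \<delta>s \<Longrightarrow> \<gamma>s ! q i = \<delta>s ! i"
    for q and \<gamma>s \<delta>s :: "'g list"
  proof -
    note \<gamma> = gr_free_simps[of \<gamma>s] and \<delta> = gr_free_simps[of \<delta>s]
    show ?thesis
      unfolding gr_hom_def hom_def
    proof (intro CollectI conjI ballI allI Pi_I)
      fix x assume "x \<in> carrier (add_monoid (gr_free S \<gamma>s))"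
      then have x: "x \<in> {..<length \<gamma>s} \<rightarrow>\<^sub>E carrier S" by (simp add: \<gamma>)
      have "x (q i) \<in> carrier S" if "i < length \<delta>s" for i using PiE_mem[OF x] q[OF that] by simp
      then show "(\<lambda>i\<in>{..<length \<delta>s}. x (q i)) \<in> carrier (add_monoid (gr_free S \<delta>s))"
        by (simp add: \<delta> restrict_PiE_iff)
    next
      fix x \<alpha> assume "x \<in> grade (gr_free S \<gamma>s) \<alpha>"
      then have x: "x \<in> (\<Pi>\<^sub>E i\<in>{..<length \<gamma>s}. grade S (\<gamma>s ! i + \<alpha>))" by (simp add: \<gamma>)
      have "x (q i) \<in> grade S (\<delta>s ! i + \<alpha>)" if "i < length \<delta>s" for i
        using PiE_mem[OF x, of "q i"] q[OF that] \<gamma>\<delta>[OF that] by simp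
      then show "(\<lambda>i\<in>{..<length \<delta>s}. x (q i)) \<in> grade (gr_free S \<delta>s) \<alpha>"
        by (simp add: \<delta> restrict_PiE_iff)
    qed (rule ext, simp add: \<gamma> \<delta> q restrict_def)+
  qed
  let ?q = "inv_into {..<length \<alpha>s} p"
  have q: "?q i < length \<alpha>s" "p (?q i) = i" if "i < length \<beta>s" for i
    using bij_betw_inv_into_right[OF p(1)] bij_betw_apply[OF bij_betw_inv_into[OF p(1)]] that by auto
  have pq: "p i < length \<beta>s" "?q (p i) = i" if "i < length \<alpha>s" for i
    using bij_betw_inv_into_left[OF p(1)] bij_betw_apply[OF p(1)] that by auto
  let ?f = "\<lambda>x :: nat \<Rightarrow> 's. \<lambda>i\<in>{..<length \<beta>s}. x (?q i)"
  let ?g = "\<lambda>x :: nat \<Rightarrow> 's. \<lambda>i\<in>{..<length \<alpha>s}. x (p i)"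
  have ext: "x i = undefined" if "x \<in> carrier (gr_free S \<gamma>s)" "\<not> i < length \<gamma>s" for x i and \<gamma>s :: "'g list"
    using that by (simp add: gr_free_simps(1) PiE_iff extensional_def)
  show ?thesis
    unfolding gr_isomorphic_def
  proof (intro bexI conjI ballI)
    show "?f \<in> gr_hom S (gr_free S \<alpha>s) (gr_free S \<beta>s)"
      by (rule hom) (use q p(2) in auto)
    show "?g \<in> gr_hom S (gr_free S \<beta>s) (gr_free S \<alpha>s)"
      by (rule hom) (use pq p(2) in auto)
    show "?g (?f x) = x" if "x \<in> carrier (gr_free S \<alpha>s)" for x
      using ext[OF that] by (intro HOL.ext) (simp add: restrict_def pq)
    show "?f (?g x) = x" if "x \<in> carrier (gr_free S \<beta>s)" for x
      using ext[OF that] by (intro HOL.ext) (simp add: restrict_def q)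
  qed
qed

end

subsection \<open>Projective modules\<close>

context scalar_units_algebra
begin

lemma scalar_units_module: "graded_module S M \<Longrightarrow> scalar_units_module K S M"
  by (intro scalar_units_module.intro algebra_module.intro scalar_units_algebra_axioms graded_algebra_axioms)

text \<open>The expansion in basis vectors writes \<open>x\<close> as a sum of products with left
  factors in \<open>\<mm>\<close>.\<close>

lemma nonzero_degree_coordinates_in_ideal_smult:
  assumes x: "x \<in> carrier (gr_free S \<alpha>s)" and m: "\<And>i. i < length \<alpha>s \<Longrightarrow> x i \<in> \<mm>"
  shows "x \<in> ideal_smult \<mm> (gr_free S \<alpha>s)"
proof -
  let ?F = "gr_free S \<alpha>s"
  interpret F: graded_module S ?F by (rule graded_module_gr_free)
  have "subgroup (ideal_smult \<mm> ?F) (add_monoid ?F)"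
    unfolding ideal_smult_def
    by (rule F.M.add.generate_is_subgroup) (auto simp: nonzero_degree_part_eq F.smult_closed)
  then have "(\<Oplus>\<^bsub>?F\<^esub>j\<in>{..<length \<alpha>s}. x j \<odot>\<^bsub>?F\<^esub> basis_vector (length \<alpha>s) j) \<in> ideal_smult \<mm> ?F"
  proof (rule F.M.subgroup_finsum)
    fix j assume "j \<in> {..<length \<alpha>s}"
    then show "x j \<odot>\<^bsub>?F\<^esub> basis_vector (length \<alpha>s) j \<in> ideal_smult \<mm> ?F"
      unfolding ideal_smult_def using m basis_vector_closed by (intro generate.incl) blast
  qed
  then show ?thesis unfolding gr_free_expansion[OF x, symmetric] .
qed

lemma gr_projective_imp_free:
  assumes fg: "fin_gen S P" and proj: "gr_projective S P"
  shows "\<exists>\<alpha>s. gr_isomorphic S P (gr_free S \<alpha>s)"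
proof -
  have P: "graded_module S P" using proj by (simp add: gr_projective_def)
  interpret P: scalar_units_module K S P by (rule scalar_units_module[OF P])
  define Q where "Q G \<longleftrightarrow> finite G \<and> G \<subseteq> (\<Union>\<alpha>. grade P \<alpha>) \<and> P.M.is_submodule hull G = carrier P" for G
  obtain G0 where "Q G0" unfolding Q_def by (rule P.fin_gen_homogeneous[OF fg]) blast
  then obtain G where G: "Q G" and min: "\<And>G'. Q G' \<Longrightarrow> card G \<le> card G'"
    using ex_has_least_nat[of Q G0 card] by blast
  obtain xs where xs: "set xs = G" "distinct xs"
    using G finite_distinct_list unfolding Q_def by blast
  have "\<forall>x\<in>G. \<exists>\<alpha>. x \<in> grade P \<alpha>" using G unfolding Q_def by blast
  then obtain d where d: "\<And>x. x \<in> G \<Longrightarrow> x \<in> grade P (d x)" by metis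
  define n where "n = length xs"
  \<comment> \<open>The sign gives each basis vector the degree \<open>d x\<close> of the generator
    to which it is sent.\<close>
  define \<alpha>s where "\<alpha>s = map (\<lambda>x. - d x) xs"
  let ?F = "gr_free S \<alpha>s" and ?\<pi> = "free_map {..<n} ((!) xs) S P"
  have n: "length \<alpha>s = n" by (simp add: \<alpha>s_def n_def)
  have \<alpha>s: "\<alpha>s ! i = - d (xs ! i)" if "i < n" for i using that by (simp add: \<alpha>s_def n_def)
  have xsG: "xs ! i \<in> G" if "i < n" for i using that xs by (auto simp: n_def)
  have xsP: "xs ! i \<in> carrier P" if "i < n" for i using d[OF xsG[OF that]] by (rule P.M.grade_closed)
  have F: "graded_module S ?F" by (rule graded_module_gr_free)
  interpret F: scalar_units_module K S ?F by (rule scalar_units_module[OF F])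
  have \<pi>: "?\<pi> \<in> gr_hom S ?F P"
    using free_map_gr_free_hom[OF P, of \<alpha>s "(!) xs"] d[OF xsG] by (simp add: n \<alpha>s)
  have img: "P.M.is_submodule (?\<pi> ` carrier ?F)" by (rule gr_hom_image_submodule[OF F P \<pi>])
  have "G \<subseteq> ?\<pi> ` carrier ?F"
  proof
    fix x assume "x \<in> G"
    then obtain j where j: "j < n" "x = xs ! j" using xs by (auto simp: n_def in_set_conv_nth)
    have "?\<pi> (basis_vector n j) = x"
      unfolding j(2) using xsP j(1) by (intro free_map_basis_vector[OF P]) auto
    then show "x \<in> ?\<pi> ` carrier ?F" using basis_vector_closed[of \<alpha>s j] unfolding n by blast
  qed
  then have "P.M.is_submodule hull G \<subseteq> ?\<pi> ` carrier ?F"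
    using img by (rule hull_minimal)
  then have "carrier P \<subseteq> ?\<pi> ` carrier ?F"
    using G unfolding Q_def by simp
  then have surj: "?\<pi> ` carrier ?F = carrier P" using gr_homD(1)[OF \<pi>] by blast
  have "(\<lambda>x. x) \<in> gr_hom S P P" by (auto simp: gr_hom_def hom_def)
  \<comment> \<open>A section, obtained by lifting the identity of \<open>P\<close> along the
    surjection.\<close>
  then obtain s where s: "s \<in> gr_hom S P ?F" and \<pi>s: "\<And>x. x \<in> carrier P \<Longrightarrow> ?\<pi> (s x) = x"
    using gr_projective_lift[OF graded_algebra_axioms proj F P \<pi> surj] by blast
  \<comment> \<open>Here minimality enters. If \<open>c i\<close> had a nonzero degree 0 part, that
    part would be a unit, and the relation taken in the degree of the generator
    \<open>xs ! i\<close> would express this generator by the others.\<close>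
  have ker: "c i \<in> \<mm>" if c: "c \<in> carrier ?F" and c0: "?\<pi> c = \<zero>\<^bsub>P\<^esub>" and i: "i < n" for c i
  proof (rule ccontr)
    assume nm: "c i \<notin> \<mm>"
    have cc: "c j \<in> carrier S" if "j < n" for j using c that by (auto simp: gr_free_simps n)
    let ?u = "part (c i) 0" and ?H = "P.M.is_submodule hull (G - {xs ! i})"
    let ?t = "\<lambda>j. part (c j) (d (xs ! i) - d (xs ! j)) \<odot>\<^bsub>P\<^esub> xs ! j"
    have u: "?u \<in> grade S 0" "?u \<noteq> \<zero>" "?u \<in> carrier S"
      using nm cc[OF i] part_grade part_closed by (auto simp: nonzero_degree_part_eq)
    have t: "?t j \<in> carrier P" if "j < n" for j
      using that cc xsP by (intro P.M.smult_closed part_closed) auto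
    have "G - {xs ! i} \<subseteq> carrier P" using d P.M.grade_closed by blast
    then have H: "P.M.is_submodule ?H" by (rule P.M.is_submodule_hull)
    have "\<zero>\<^bsub>P\<^esub> = P.M.component (?\<pi> c) (d (xs ! i))" by (simp add: c0)
    also have "?\<pi> c = (\<Oplus>\<^bsub>P\<^esub>j\<in>{..<n}. c j \<odot>\<^bsub>P\<^esub> xs ! j)"
      using cc xsP by (intro free_map_eq_finsum[OF P]) auto
    also have "P.M.component \<dots> (d (xs ! i)) = (\<Oplus>\<^bsub>P\<^esub>j\<in>{..<n}. P.M.component (c j \<odot>\<^bsub>P\<^esub> xs ! j) (d (xs ! i)))"
      using cc xsP by (intro P.M.comp_finsum P.M.smult_closed) auto
    also have "\<dots> = (\<Oplus>\<^bsub>P\<^esub>j\<in>{..<n}. ?t j)"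
    proof (rule P.M.M.finsum_cong')
      fix j assume "j \<in> {..<n}"
      then show "P.M.component (c j \<odot>\<^bsub>P\<^esub> xs ! j) (d (xs ! i)) = ?t j"
        using cc d xsG by (intro P.comp_smult_of_homogeneous) auto
    qed (use t in auto)
    also have "{..<n} = insert i ({..<n} - {i})" using i by auto
    also have "(\<Oplus>\<^bsub>P\<^esub>j\<in>insert i ({..<n} - {i}). ?t j) = ?t i \<oplus>\<^bsub>P\<^esub> (\<Oplus>\<^bsub>P\<^esub>j\<in>{..<n} - {i}. ?t j)"
      using t t[OF i] by (intro P.M.M.finsum_insert) auto
    finally have eq: "?t i \<oplus>\<^bsub>P\<^esub> (\<Oplus>\<^bsub>P\<^esub>j\<in>{..<n} - {i}. ?t j) = \<zero>\<^bsub>P\<^esub>" ..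
    have R: "(\<Oplus>\<^bsub>P\<^esub>j\<in>{..<n} - {i}. ?t j) \<in> ?H"
    proof (rule P.M.is_submodule_finsum[OF H])
      fix j assume j: "j \<in> {..<n} - {i}"
      then have "xs ! j \<in> G - {xs ! i}"
        using xsG xs(2) i by (auto simp: n_def nth_eq_iff_index_eq)
      then show "?t j \<in> ?H"
        using j cc by (intro P.M.is_submoduleD(4)[OF H] hull_inc part_closed) auto
    qed
    have "?t i = \<ominus>\<^bsub>P\<^esub> (\<Oplus>\<^bsub>P\<^esub>j\<in>{..<n} - {i}. ?t j)"
      using eq t[OF i] P.M.is_submoduleD(1)[OF H] R by (intro P.M.M.minus_equality[symmetric]) auto
    then have ti: "?u \<odot>\<^bsub>P\<^esub> xs ! i \<in> ?H"
      using P.M.is_submodule_minus[OF H R] by simp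
    have "?u \<in> Units S" using degree_zero_Units u by blast
    then have "inv ?u \<odot>\<^bsub>P\<^esub> (?u \<odot>\<^bsub>P\<^esub> xs ! i) = xs ! i" "inv ?u \<in> carrier S"
      using u xsP[OF i] by (simp_all add: P.M.smult_assoc[symmetric] P.M.smult_one)
    then have xi: "xs ! i \<in> ?H" using P.M.is_submoduleD(4)[OF H _ ti] by metis
    have "G = insert (xs ! i) (G - {xs ! i})" using xsG[OF i] by blast
    then have "?H = carrier P" using hull_redundant[OF xi] G unfolding Q_def by metis
    then have "Q (G - {xs ! i})" using G unfolding Q_def by auto
    then have "card G \<le> card (G - {xs ! i})" by (rule min)
    moreover have "card (G - {xs ! i}) < card G"
      using G xsG[OF i] unfolding Q_def by (intro card_Diff1_less) auto
    ultimately show False by simp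
  qed
  have simg: "F.M.is_submodule (s ` carrier P)" by (rule gr_hom_image_submodule[OF P F s])
  have "s ` carrier P = carrier ?F"
  \<comment> \<open>The submodule is the image of the section and the generators are the basis
    vectors. Each \<open>y\<close> differs from \<open>s (?\<pi> y)\<close> by a kernel element,
    which lies in \<open>\<mm>\<close> times the free module.\<close>
  proof (rule F.nakayama[OF _ _ simg])
    let ?E = "basis_vector n ` {..<n}"
    show "finite ?E" by simp
    show E: "?E \<subseteq> (\<Union>\<alpha>. grade ?F \<alpha>)"
      using basis_vector_grade[of _ \<alpha>s] unfolding n by blast
    show "F.M.component y \<alpha> \<in> s ` carrier P" if "y \<in> s ` carrier P" for y \<alpha>
      using that gr_hom_component[OF P F s] P.M.comp_closed by auto
    have sub: "s ` carrier P \<union> ?E \<subseteq> carrier ?F"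
      using gr_homD(1)[OF s] basis_vector_closed[of \<alpha>s] unfolding n by blast
    show "F.M.is_submodule hull (s ` carrier P \<union> ?E) = carrier ?F"
    proof (rule subset_antisym)
      show "F.M.is_submodule hull (s ` carrier P \<union> ?E) \<subseteq> carrier ?F"
        using sub F.M.is_submodule_carrier by (rule hull_minimal)
      show "carrier ?F \<subseteq> F.M.is_submodule hull (s ` carrier P \<union> ?E)"
        using n by (intro gr_free_span F.M.is_submodule_hull[OF sub] hull_inc) auto
    qed
    fix y assume y: "y \<in> carrier ?F"
    let ?z = "\<ominus>\<^bsub>?F\<^esub> s (?\<pi> y) \<oplus>\<^bsub>?F\<^esub> y"
    have \<pi>y: "?\<pi> y \<in> carrier P" using gr_homD(1)[OF \<pi> y] .
    have spy: "s (?\<pi> y) \<in> carrier ?F" using gr_homD(1)[OF s \<pi>y] .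
    have z: "?z \<in> carrier ?F" using y spy by simp
    have yz: "y = s (?\<pi> y) \<oplus>\<^bsub>?F\<^esub> ?z" using spy y by (rule F.M.M.r_neg2[symmetric])
    have "?\<pi> y = ?\<pi> (s (?\<pi> y) \<oplus>\<^bsub>?F\<^esub> ?z)" by (rule arg_cong[OF yz])
    also have "\<dots> = ?\<pi> y \<oplus>\<^bsub>P\<^esub> ?\<pi> ?z"
      unfolding gr_homD(2)[OF \<pi> spy z] \<pi>s[OF \<pi>y] ..
    finally have "?\<pi> y = ?\<pi> y \<oplus>\<^bsub>P\<^esub> ?\<pi> ?z" .
    then have "?\<pi> ?z = \<zero>\<^bsub>P\<^esub>"
      using \<pi>y gr_homD(1)[OF \<pi> z] by (metis P.M.M.add.l_cancel_one)
    then have "?z \<in> ideal_smult \<mm> ?F"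
      using ker[OF z] n by (intro nonzero_degree_coordinates_in_ideal_smult[OF z]) auto
    then show "\<exists>l\<in>s ` carrier P. \<exists>z\<in>ideal_smult \<mm> ?F. y = l \<oplus>\<^bsub>?F\<^esub> z"
      using yz \<pi>y by blast
  qed
  then have "s (?\<pi> y) = y" if "y \<in> carrier ?F" for y
    using that \<pi>s by (metis imageE)
  then show ?thesis
    unfolding gr_isomorphic_def using s \<pi> \<pi>s by blast
qed

end

subsection \<open>Isomorphisms of graded free modules\<close>

text \<open>Gaussian elimination in a subring that is a division ring: an equation with a nonzero
  coefficient at the index \<open>i\<close> expresses the \<open>i\<close>-th unknown by the others.\<close>

lemma (in ring) homogeneous_system_solution:
  assumes D: "subring D R" and inv: "\<And>x. x \<in> D \<Longrightarrow> x \<noteq> \<zero> \<Longrightarrow> \<exists>y\<in>D. y \<otimes> x = \<one>" and "\<one> \<noteq> \<zero>"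
    and "finite J" "finite I" "card J < card I"
    and "\<And>i j. i \<in> I \<Longrightarrow> j \<in> J \<Longrightarrow> A i j \<in> D"
  shows "\<exists>v\<in>I \<rightarrow> D. (\<exists>i\<in>I. v i \<noteq> \<zero>) \<and> (\<forall>j\<in>J. (\<Oplus>i\<in>I. v i \<otimes> A i j) = \<zero>)"
  using assms(4-)
proof (induct J arbitrary: I A)
  case empty
  then obtain i where "i \<in> I" by (metis card.empty equals0I less_irrefl)
  then show ?case
    using subringE(3)[OF D] \<open>\<one> \<noteq> \<zero>\<close> by (intro bexI[of _ "\<lambda>_. \<one>"]) auto
next
  case (insert l J)
  have Dc: "x \<in> carrier R" if "x \<in> D" for x using subringE(1)[OF D] that by blast
  have D0: "\<zero> \<in> D" and Dm: "\<And>x y. x \<in> D \<Longrightarrow> y \<in> D \<Longrightarrow> x \<otimes> y \<in> D"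
    and Da: "\<And>x y. x \<in> D \<Longrightarrow> y \<in> D \<Longrightarrow> x \<oplus> y \<in> D" and Dn: "\<And>x. x \<in> D \<Longrightarrow> \<ominus> x \<in> D"
    using subringE[OF D] by auto
  show ?case
  proof (cases "\<forall>i\<in>I. A i l = \<zero>")
    case True
    have "\<exists>v\<in>I \<rightarrow> D. (\<exists>i\<in>I. v i \<noteq> \<zero>) \<and> (\<forall>j\<in>J. (\<Oplus>i\<in>I. v i \<otimes> A i j) = \<zero>)"
      using insert.prems insert.hyps by (intro insert.hyps(3)) auto
    then obtain v where v: "v \<in> I \<rightarrow> D" "\<exists>i\<in>I. v i \<noteq> \<zero>" "\<forall>j\<in>J. (\<Oplus>i\<in>I. v i \<otimes> A i j) = \<zero>" by blast
    have "(\<Oplus>i\<in>I. v i \<otimes> A i l) = (\<Oplus>i\<in>I. \<zero>)"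
    proof (rule finsum_cong')
      fix i assume "i \<in> I"
      then show "v i \<otimes> A i l = \<zero>" using True Dc[OF funcset_mem[OF v(1)]] by simp
    qed auto
    then have "(\<Oplus>i\<in>I. v i \<otimes> A i l) = \<zero>" by simp
    then show ?thesis using v by blast
  next
    case False
    then obtain p where p: "p \<in> I" "A p l \<noteq> \<zero>" by blast
    have AD: "A i j \<in> D" if "i \<in> I" "j \<in> insert l J" for i j using insert.prems(3) that by blast
    obtain q where q: "q \<in> D" "q \<otimes> A p l = \<one>" using inv[OF AD[OF p(1)] p(2)] by blast
    let ?I = "I - {p}"
    \<comment> \<open>Row \<open>i\<close> minus a left multiple of the pivot row \<open>p\<close>,
      chosen to clear column \<open>l\<close>. Unknowns multiply from the left, so a left inverse
      \<open>q\<close> of the pivot is what is required.\<close>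
    let ?B = "\<lambda>i j. A i j \<oplus> \<ominus> (A i l \<otimes> q \<otimes> A p j)"
    have BD: "?B i j \<in> D" if "i \<in> ?I" "j \<in> insert l J" for i j
      using that q p by (intro Da Dn Dm AD) auto
    have "card J < card ?I" using insert.prems insert.hyps(1,2) p by (simp add: card_Diff_singleton)
    then have "\<exists>v\<in>?I \<rightarrow> D. (\<exists>i\<in>?I. v i \<noteq> \<zero>) \<and> (\<forall>j\<in>J. (\<Oplus>i\<in>?I. v i \<otimes> ?B i j) = \<zero>)"
      using insert.prems(1) BD by (intro insert.hyps(3)) auto
    then obtain v where v: "v \<in> ?I \<rightarrow> D" "\<exists>i\<in>?I. v i \<noteq> \<zero>" "\<And>j. j \<in> J \<Longrightarrow> (\<Oplus>i\<in>?I. v i \<otimes> ?B i j) = \<zero>"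
      by blast
    have vD: "v i \<in> D" if "i \<in> ?I" for i using funcset_mem[OF v(1) that] .
    let ?s = "\<Oplus>i\<in>?I. v i \<otimes> (A i l \<otimes> q)"
    have tD: "v i \<otimes> (A i l \<otimes> q) \<in> D" if "i \<in> ?I" for i
      using that q by (intro Dm vD AD) auto
    have sD: "?s \<in> D"
      using tD D by (intro subgroup_finsum) (auto simp: subring_def)
    have vA: "v i \<otimes> A i j \<in> carrier R" if "i \<in> ?I" "j \<in> insert l J" for i j
      using that by (intro m_closed Dc vD AD) auto
    \<comment> \<open>The value of the pivot unknown is dictated by equation
      \<open>l\<close>.\<close>
    let ?v = "v(p := \<ominus> ?s)"
    have split: "(\<Oplus>i\<in>I. ?v i \<otimes> A i j) = \<ominus> (?s \<otimes> A p j) \<oplus> (\<Oplus>i\<in>?I. v i \<otimes> A i j)"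
      if j: "j \<in> insert l J" for j
    proof -
      have "(\<Oplus>i\<in>insert p ?I. ?v i \<otimes> A i j) = ?v p \<otimes> A p j \<oplus> (\<Oplus>i\<in>?I. ?v i \<otimes> A i j)"
      proof (rule finsum_insert)
        show "(\<lambda>i. ?v i \<otimes> A i j) \<in> ?I \<rightarrow> carrier R"
          using vA[OF _ j] by auto
        show "?v p \<otimes> A p j \<in> carrier R" using sD AD[OF p(1) j] by (intro m_closed Dc) (auto intro: Dn)
      qed (use insert.prems(1) in auto)
      also have "(\<Oplus>i\<in>?I. ?v i \<otimes> A i j) = (\<Oplus>i\<in>?I. v i \<otimes> A i j)"
        using vA[OF _ j] by (intro finsum_cong') auto
      also have "?v p \<otimes> A p j = \<ominus> (?s \<otimes> A p j)"
        using Dc[OF sD] Dc[OF AD[OF p(1) j]] by (simp add: l_minus)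
      also have "insert p ?I = I" using p(1) by blast
      finally show ?thesis .
    qed
    have vs: "v i \<otimes> (A i l \<otimes> q \<otimes> A p j) \<in> carrier R" if "i \<in> ?I" "j \<in> insert l J" for i j
      using that p(1) q(1) by (intro m_closed Dc vD AD) auto
    have sA: "?s \<otimes> A p j = (\<Oplus>i\<in>?I. v i \<otimes> (A i l \<otimes> q \<otimes> A p j))" if j: "j \<in> insert l J" for j
    proof -
      have "?s \<otimes> A p j = (\<Oplus>i\<in>?I. v i \<otimes> (A i l \<otimes> q) \<otimes> A p j)"
        using insert.prems(1) tD AD[OF p(1) j] by (intro finsum_ldistr) (auto intro!: Dc)
      also have "\<dots> = (\<Oplus>i\<in>?I. v i \<otimes> (A i l \<otimes> q \<otimes> A p j))"
      proof (rule finsum_cong')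
        fix i assume i: "i \<in> ?I"
        then have "v i \<in> carrier R" "A i l \<in> carrier R" "q \<in> carrier R" "A p j \<in> carrier R"
          using vD AD q(1) p(1) j by (auto intro!: Dc)
        then show "v i \<otimes> (A i l \<otimes> q) \<otimes> A p j = v i \<otimes> (A i l \<otimes> q \<otimes> A p j)" by (simp add: m_assoc)
      qed (use vs[OF _ j] in auto)
      finally show ?thesis .
    qed
    have "(\<Oplus>i\<in>I. ?v i \<otimes> A i j) = \<zero>" if j: "j \<in> insert l J" for j
    proof (cases "j = l")
      case True
      have "?s \<otimes> A p l = (\<Oplus>i\<in>?I. v i \<otimes> A i l)"
        unfolding sA[OF insertI1]
      proof (rule finsum_cong')
        fix i assume i: "i \<in> ?I"
        then have "A i l \<in> carrier R" "q \<in> carrier R" "A p l \<in> carrier R"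
          using AD q(1) p(1) by (auto intro!: Dc)
        then show "v i \<otimes> (A i l \<otimes> q \<otimes> A p l) = v i \<otimes> A i l" using q(2) by (simp add: m_assoc)
      qed (use vA in auto)
      moreover have "?s \<otimes> A p l \<in> carrier R" using sD AD[OF p(1)] by (intro m_closed Dc) auto
      ultimately show ?thesis using split[OF j] True by (simp add: l_neg)
    next
      case False
      have c: "v i \<in> carrier R" "A i j \<in> carrier R" "A i l \<otimes> q \<otimes> A p j \<in> carrier R" if "i \<in> ?I" for i
        using that p(1) q(1) j by (auto intro: m_closed Dc vD AD)
      have B: "v i \<otimes> ?B i j \<in> carrier R" if "i \<in> ?I" for i
        using c[OF that] by simp
      \<comment> \<open>The second summands add up to zero because \<open>v\<close> solves the
        reduced system; the first add up to the pivot contribution, which cancels.\<close>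
      have "(\<Oplus>i\<in>?I. v i \<otimes> A i j) = (\<Oplus>i\<in>?I. v i \<otimes> (A i l \<otimes> q \<otimes> A p j) \<oplus> v i \<otimes> ?B i j)"
      proof (rule finsum_cong')
        fix i assume i: "i \<in> ?I"
        show "v i \<otimes> A i j = v i \<otimes> (A i l \<otimes> q \<otimes> A p j) \<oplus> v i \<otimes> ?B i j"
          using c[OF i] by (simp add: r_distr[symmetric] a_lcomm r_neg)
      qed (use vs[OF _ j] B in auto)
      also have "\<dots> = (\<Oplus>i\<in>?I. v i \<otimes> (A i l \<otimes> q \<otimes> A p j)) \<oplus> (\<Oplus>i\<in>?I. v i \<otimes> ?B i j)"
        using vs[OF _ j] B by (intro finsum_addf) auto
      also have "\<dots> = ?s \<otimes> A p j \<oplus> \<zero>" using v(3)[of j] j False sA[OF j] by simp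
      finally have "(\<Oplus>i\<in>?I. v i \<otimes> A i j) = ?s \<otimes> A p j \<oplus> \<zero>" .
      moreover have "?s \<otimes> A p j \<in> carrier R" using sD AD[OF p(1) j] by (intro m_closed Dc) auto
      ultimately show ?thesis using split[OF j] by (simp add: l_neg)
    qed
    moreover have "?v \<in> I \<rightarrow> D" using vD Dn[OF sD] by auto
    moreover have "\<exists>i\<in>I. ?v i \<noteq> \<zero>" using v(2) by auto
    ultimately show ?thesis by blast
  qed
qed

lemma gr_isomorphic_sym: "gr_isomorphic S M N \<Longrightarrow> gr_isomorphic S N M"
  unfolding gr_isomorphic_def by blast

lemma (in graded_algebra) gr_hom_gr_free_coordinate:
  assumes f: "f \<in> gr_hom S (gr_free S \<alpha>s) (gr_free S \<beta>s)" and x: "x \<in> carrier (gr_free S \<alpha>s)"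
    and j: "j < length \<beta>s"
  shows "f x j = (\<Oplus>i\<in>{..<length \<alpha>s}. x i \<otimes> f (basis_vector (length \<alpha>s) i) j)"
proof -
  interpret F: graded_module S "gr_free S \<beta>s" by (rule graded_module_gr_free)
  let ?b = "basis_vector (length \<alpha>s)"
  have c: "x i \<in> carrier S" "f (?b i) \<in> carrier (gr_free S \<beta>s)" if "i < length \<alpha>s" for i
    using x that gr_homD(1)[OF f basis_vector_closed] by (auto simp: gr_free_simps(1) PiE_iff)
  have "f x j = (\<Oplus>\<^bsub>gr_free S \<beta>s\<^esub>i\<in>{..<length \<alpha>s}. x i \<odot>\<^bsub>gr_free S \<beta>s\<^esub> f (?b i)) j"
    by (rule fun_cong[OF gr_hom_gr_free_expansion[OF graded_module_gr_free f x]])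
  also have "\<dots> = (\<Oplus>i\<in>{..<length \<alpha>s}. (x i \<odot>\<^bsub>gr_free S \<beta>s\<^esub> f (?b i)) j)"
    using c j by (intro finsum_gr_free F.smult_closed) auto
  also have "\<dots> = (\<Oplus>i\<in>{..<length \<alpha>s}. x i \<otimes> f (?b i) j)"
  proof (rule finsum_cong')
    show "(\<lambda>i. x i \<otimes> f (?b i) j) \<in> {..<length \<alpha>s} \<rightarrow> carrier S"
      using c j by (auto simp: gr_free_simps(1) PiE_iff)
  qed (use j in \<open>auto simp: gr_free_simps(4)\<close>)
  finally show ?thesis .
qed

section \<open>Comparing multiplicities of twists\<close>

context scalar_units_algebra
begin

lemma nonzero_degree_part_finsum: "(\<And>i. i \<in> A \<Longrightarrow> f i \<in> \<mm>) \<Longrightarrow> finsum S f A \<in> \<mm>"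
  by (rule subgroup_finsum)
    (use ideal_nonzero_degree_part in \<open>simp_all add: additive_subgroup.a_subgroup ideal_def\<close>)

text \<open>Each coordinate of the image is a sum of coordinates of \<open>x\<close> times matrix
  entries, and \<open>\<mm>\<close> absorbs right factors.\<close>

lemma gr_hom_gr_free_nonzero_degree:
  assumes f: "f \<in> gr_hom S (gr_free S \<alpha>s) (gr_free S \<beta>s)" and x: "x \<in> carrier (gr_free S \<alpha>s)"
    and m: "\<And>i. i < length \<alpha>s \<Longrightarrow> x i \<in> \<mm>" and j: "j < length \<beta>s"
  shows "f x j \<in> \<mm>"
  unfolding gr_hom_gr_free_coordinate[OF f x j]
proof (rule nonzero_degree_part_finsum)
  fix i assume "i \<in> {..<length \<alpha>s}"
  then show "x i \<otimes> f (basis_vector (length \<alpha>s) i) j \<in> \<mm>"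
    using gr_homD(1)[OF f basis_vector_closed] j
    by (intro ideal.I_r_closed[OF ideal_nonzero_degree_part] m) (auto simp: gr_free_simps(1) PiE_iff)
qed

lemma degree_zero_subring: "subring (grade S 0) S"
proof (rule subringI)
  show "x \<otimes> y \<in> grade S 0" if "x \<in> grade S 0" "y \<in> grade S 0" for x y
    using grade_mult[OF that] by simp
qed (auto simp: grade_in_carrier grade_one minus_in_grade add_in_grade)

text \<open>The inverse exists in \<open>S\<close>; its degree 0 part is still a left inverse
  because degree 0 parts are multiplicative.\<close>

lemma degree_zero_left_inverse:
  assumes "x \<in> grade S 0" "x \<noteq> \<zero>"
  shows "\<exists>y\<in>grade S 0. y \<otimes> x = \<one>"
proof
  let ?y = "part (inv x) 0"
  have u: "x \<in> Units S" using degree_zero_Units[OF assms] .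
  then have "part (inv x \<otimes> x) 0 = ?y \<otimes> part x 0" by (intro part_mult_zero) auto
  then show "?y \<otimes> x = \<one>" using u assms(1) grade_one by (simp add: part_homogeneous)
  show "?y \<in> grade S 0" using u by (intro part_grade) auto
qed

text \<open>A graded isomorphism preserves the vectors with coordinates in \<open>\<mm>\<close>. With too few
  summands of twist \<open>\<alpha>\<close> in the target, some nonzero vector of degree \<open>- \<alpha>\<close> with scalar
  coordinates would be mapped to such a vector.\<close>

lemma gr_isomorphic_imp_card_le:
  assumes "gr_isomorphic S (gr_free S \<alpha>s) (gr_free S \<beta>s)"
  shows "card {i. i < length \<alpha>s \<and> \<alpha>s ! i = \<alpha>} \<le> card {j. j < length \<beta>s \<and> \<beta>s ! j = \<alpha>}"
    (is "card ?I \<le> card ?J")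
proof (rule ccontr)
  assume "\<not> ?thesis"
  then have lt: "card ?J < card ?I" by simp
  obtain f g where f: "f \<in> gr_hom S (gr_free S \<alpha>s) (gr_free S \<beta>s)"
    and g: "g \<in> gr_hom S (gr_free S \<beta>s) (gr_free S \<alpha>s)"
    and gf: "\<And>x. x \<in> carrier (gr_free S \<alpha>s) \<Longrightarrow> g (f x) = x"
    using assms unfolding gr_isomorphic_def by blast
  let ?A = "\<lambda>i. f (basis_vector (length \<alpha>s) i)"
  \<comment> \<open>The matrix entries of \<open>f\<close> are homogeneous, and those between
    summands of equal twist have degree 0. The block for twist \<alpha> is thus a matrix over the
    degree 0 subring.\<close>
  have A: "?A i j \<in> grade S (\<beta>s ! j - \<alpha>s ! i)" if "i < length \<alpha>s" "j < length \<beta>s" for i j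
    using gr_homD(4)[OF f basis_vector_grade[OF that(1)]] that(2)
    by (auto simp: gr_free_simps(5) PiE_iff)
  have "?A i j \<in> grade S 0" if "i \<in> ?I" "j \<in> ?J" for i j
    using A[of i j] that by simp
  then have "\<exists>v\<in>?I \<rightarrow> grade S 0. (\<exists>i\<in>?I. v i \<noteq> \<zero>) \<and> (\<forall>j\<in>?J. (\<Oplus>i\<in>?I. v i \<otimes> ?A i j) = \<zero>)"
    using lt one_not_zero degree_zero_left_inverse
    by (intro homogeneous_system_solution[OF degree_zero_subring]) auto
  then obtain v p where v: "v \<in> ?I \<rightarrow> grade S 0" and p: "p \<in> ?I" "v p \<noteq> \<zero>"
    and sol: "\<And>j. j \<in> ?J \<Longrightarrow> (\<Oplus>i\<in>?I. v i \<otimes> ?A i j) = \<zero>" by blast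
  have v0: "v i \<in> grade S 0" if "i \<in> ?I" for i using funcset_mem[OF v that] .
  \<comment> \<open>The solution extended by zero, a vector of degree -\<alpha>. The coordinates of
    its image at twist \<alpha> vanish by the equations, and the others have nonzero degree.\<close>
  define w where "w = (\<lambda>i\<in>{..<length \<alpha>s}. if \<alpha>s ! i = \<alpha> then v i else \<zero>)"
  have wg: "w \<in> grade (gr_free S \<alpha>s) (- \<alpha>)"
    unfolding gr_free_simps(5) w_def restrict_PiE_iff using v0 zero_in_grade by auto
  interpret F: graded_module S "gr_free S \<alpha>s" by (rule graded_module_gr_free)
  have wc: "w \<in> carrier (gr_free S \<alpha>s)" using wg by (rule F.grade_closed)
  have fw: "f w j \<in> \<mm>" if j: "j < length \<beta>s" for j
  proof (cases "\<beta>s ! j = \<alpha>")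
    case False
    have "f w j \<in> grade S (\<beta>s ! j - \<alpha>)"
      using gr_homD(4)[OF f wg] j by (auto simp: gr_free_simps(5) PiE_iff)
    then show ?thesis
      using False by (auto simp: nonzero_degree_part_eq part_homogeneous grade_in_carrier)
  next
    case True
    have Ac: "?A i j \<in> carrier S" if "i < length \<alpha>s" for i
      using A[OF that j] by (rule grade_in_carrier)
    have vA: "v i \<otimes> ?A i j \<in> carrier S" if "i < length \<alpha>s" "\<alpha>s ! i = \<alpha>" for i
      using that by (intro m_closed grade_in_carrier[OF v0] Ac) auto
    have "f w j = (\<Oplus>i\<in>{..<length \<alpha>s}. w i \<otimes> ?A i j)"
      by (rule gr_hom_gr_free_coordinate[OF f wc j])
    also have "\<dots> = (\<Oplus>i\<in>?I. w i \<otimes> ?A i j)"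
      using vA Ac by (intro reg.finsum_extend[simplified, symmetric]) (auto simp: w_def)
    also have "\<dots> = (\<Oplus>i\<in>?I. v i \<otimes> ?A i j)"
      using vA by (intro finsum_cong') (auto simp: w_def)
    also have "\<dots> = \<zero>" using sol True j by simp
    finally show ?thesis by (simp add: nonzero_degree_part_eq)
  qed
  \<comment> \<open>The inverse \<open>g\<close> also preserves coordinates in \<open>\<mm>\<close>,
    which puts \<open>v p\<close>, a nonzero element of degree 0, into \<open>\<mm>\<close>.\<close>
  have "g (f w) p \<in> \<mm>"
    using p(1) fw by (intro gr_hom_gr_free_nonzero_degree[OF g gr_homD(1)[OF f wc]]) auto
  then have "v p \<in> \<mm>" using p(1) gf[OF wc] by (simp add: w_def)
  then show False
    using p v0[OF p(1)] by (simp add: nonzero_degree_part_eq part_homogeneous)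
qed

lemma gr_free_isomorphic_iff:
  "gr_isomorphic S (gr_free S \<alpha>s) (gr_free S \<beta>s) \<longleftrightarrow> mset \<alpha>s = mset \<beta>s"
proof
  assume iso: "gr_isomorphic S (gr_free S \<alpha>s) (gr_free S \<beta>s)"
  show "mset \<alpha>s = mset \<beta>s"
  proof (rule multiset_eqI)
    fix \<alpha>
    have "count (mset \<gamma>s) \<alpha> = card {i. i < length \<gamma>s \<and> \<gamma>s ! i = \<alpha>}" for \<gamma>s :: "'g list"
      by (simp add: count_mset count_list_eq_length_filter length_filter_conv_card eq_commute)
    then show "count (mset \<alpha>s) \<alpha> = count (mset \<beta>s) \<alpha>"
      using gr_isomorphic_imp_card_le[OF iso, of \<alpha>]
        gr_isomorphic_imp_card_le[OF gr_isomorphic_sym[OF iso], of \<alpha>] by simp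
  qed
qed (rule gr_free_isomorphic_mset)

end

theorem lemma2p2:
  fixes K :: "'k ring" and S :: "('g::ab_group_add, 'k, 's) gmodule"
  assumes "graded_algebra K S"
    and "bij_betw (\<lambda>a. a \<odot>\<^bsub>S\<^esub> \<one>\<^bsub>S\<^esub>) (carrier K) (grade S 0)"
    and "{u \<in> Units S. \<exists>\<alpha>. u \<in> grade S \<alpha>} = (\<lambda>a. a \<odot>\<^bsub>S\<^esub> \<one>\<^bsub>S\<^esub>) ` (carrier K - {\<zero>\<^bsub>K\<^esub>})"
  shows "(\<forall>J. maximal_graded_ideal S J \<longleftrightarrow> J = nonzero_degree_part S) \<and>
    (\<forall>M :: ('g, 's, 'm) gmodule.
       graded_module S M \<and> fin_gen S M \<and> ideal_smult (nonzero_degree_part S) M = carrier M \<longrightarrow>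
       carrier M = {\<zero>\<^bsub>M\<^esub>}) \<and>
    (\<forall>P :: ('g, 's, 'p) gmodule. fin_gen S P \<and> gr_projective S P \<longrightarrow>
       (\<exists>\<alpha>s. gr_isomorphic S P (gr_free S \<alpha>s))) \<and>
    (\<forall>\<alpha>s \<beta>s. gr_isomorphic S (gr_free S \<alpha>s) (gr_free S \<beta>s) \<longleftrightarrow> mset \<alpha>s = mset \<beta>s)"
proof -
  interpret scalar_units_algebra K S
    using assms by (simp add: scalar_units_algebra_def scalar_units_algebra_axioms_def)
  show ?thesis
  proof (intro conjI allI impI)
    show "maximal_graded_ideal S J \<longleftrightarrow> J = \<mm>" for J
      by (rule maximal_graded_ideal_iff)
    show "carrier M = {\<zero>\<^bsub>M\<^esub>}"
      if "graded_module S M \<and> fin_gen S M \<and> ideal_smult \<mm> M = carrier M" for M :: "('g, 's, 'm) gmodule"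
      using that scalar_units_module.graded_nakayama[OF scalar_units_module] by blast
    show "\<exists>\<alpha>s. gr_isomorphic S P (gr_free S \<alpha>s)"
      if "fin_gen S P \<and> gr_projective S P" for P :: "('g, 's, 'p) gmodule"
      using that gr_projective_imp_free by blast
    show "gr_isomorphic S (gr_free S \<alpha>s) (gr_free S \<beta>s) \<longleftrightarrow> mset \<alpha>s = mset \<beta>s" for \<alpha>s \<beta>s
      by (rule gr_free_isomorphic_iff)
  qed
qed

end
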